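(* With the notation of the context, let $(d_i)$ be the poles of $r_y$ in $\mathbb{C}$ and $R_{d_i,y}$ the principal part of $r_y$ at $d_i$. Let $(P_m)_{m\ge1}$ be parallelograms in $\mathbb{C}$ such that (1) $P_1\subset P_2\subset\cdots$; (2) $\bigcup_m P_m=\mathbb{C}$; (3) every $P_m$ is centered at $\omega_{y_2}$ (symmetric with respect to $\omega_{y_2}$); (4) there are constants $C_1,C_2>0$ with $\sup_{\omega\in\partial P_m}|r_y(\omega)|\le C_1m$ and $\inf_{\omega\in\partial P_m}|\omega-\omega_{y_2}|\ge C_2m$ for all $m\ge1$. Then for every $\omega\in\mathbb{C}$ which is not a pole of $r_y$, $$r_y(\omega)-r_y(\omega_{y_2})=\lim_{m\to\infty}\sum_{d_i\in P_m}\{R_{d_i,y}(\omega)-R_{d_i,y}(\omega_{y_2})\}.$$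
   Context: Let $S\subset\{-1,0,1\}^2\setminus\{(0,0)\}$ be one of the 74 non-singular models of walks with small steps in the quarter plane (the 79 inherently different nontrivial models of Bousquet-Mélou–Mishna minus the five models with no step in $\{(-1,0),(-1,-1),(0,-1)\}$); $\delta_{i,j}=1$ if $(i,j)\in S$, else $0$. Let $Q(x,y)=\sum_{i,j,n}q(i,j;n)x^iy^jz^n$ where $q(i,j;n)$ counts length-$n$ walks in $\mathbb{Z}_+^2$ with steps in $S$ from $(0,0)$ to $(i,j)$, and $K(x,y)=xyz[\sum_{(i,j)\in S}x^iy^j-1/z]$, $z\in(0,1/|S|)$ fixed. Let $d,\tilde d$ be the discriminants $d(x)=(zx^2\delta_{1,0}-x+z\delta_{-1,0})^2-4z^2(x^2\delta_{1,1}+x\delta_{0,1}+\delta_{-1,1})(x^2\delta_{1,-1}+x\delta_{0,-1}+\delta_{-1,-1})$ and its analogue $\tilde d(y)$ with coordinates exchanged, with roots (branch points) $x_1..x_4$, $y_1..y_4$ numbered as in Kurkova–Raschel (Publ. Math. IHES 2012); $\omega_1=i\int_{x_1}^{x_2}dx/\sqrt{-d(x)}$, $\omega_2=\int_{x_2}^{x_3}dx/\sqrt{d(x)}$, $\omega_3=\int_{X(y_1)}^{x_1}dx/\sqrt{d(x)}$ where $K(X(y),y)=0$; $\wp$ Weierstrass with periods $\omega_1,\omega_2$; $g_x(t)=d''(x_4)/6+d'(x_4)/(t-x_4)$ (or $d''(0)/6+d'''(0)t/6$ if $x_4=\infty$), $g_y$ likewise; $x(\omega)=g_x^{-1}(\wp(\omega))$,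 $y(\omega)=g_y^{-1}(\wp(\omega-\omega_3/2))$; $\omega_{y_2}=(\omega_1+\omega_2+\omega_3)/2$. $\Delta_y$ is the connected component of $\{\omega:|y(\omega)|<1\}$ containing the line $\Re\omega=\Re\omega_{y_2}$, and $r_y$ is the meromorphic function on $\mathbb{C}$ (meromorphic continuation) equal to $K(0,y(\omega))Q(0,y(\omega))$ on $\Delta_y$. The principal part at $d$ is the sum of negative-power terms of the Laurent expansion at $d$. *)

theory Defs
  imports "HOL-Complex_Analysis.Complex_Analysis"
begin

section \<open>Models of walks in the quarter plane\<close>

definition small_steps :: "(int \<times> int) set" where
  "small_steps = {-1..1} \<times> {-1..1} - {(0, 0)}"

text \<open>
  The nontrivial models of Bousquet-Melou and Mishna: walks of positive length exist, both
  coordinates can increase and decrease, and neither of the two positivity constraints implies the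
  other one. There are 138 such step sets, falling into 79 classes under exchange of coordinates;
  131 of them are non-singular, falling into 74 classes. No representative is singled out.
\<close>

definition nontrivial_model :: "(int \<times> int) set \<Rightarrow> bool" where
  "nontrivial_model S \<longleftrightarrow> S \<subseteq> small_steps \<and>
     (\<exists>(i,j)\<in>S. i \<ge> 0 \<and> j \<ge> 0) \<and>
     (\<exists>(i,j)\<in>S. i > 0) \<and> (\<exists>(i,j)\<in>S. i < 0) \<and>
     (\<exists>(i,j)\<in>S. j > 0) \<and> (\<exists>(i,j)\<in>S. j < 0) \<and>
     (\<exists>(i,j)\<in>S. i > j) \<and> (\<exists>(i,j)\<in>S. i < j)"

definition nonsingular_model :: "(int \<times> int) set \<Rightarrow> bool" where
  "nonsingular_model S \<longleftrightarrow> nontrivial_model S \<and> S \<inter> {(-1, 0), (-1, -1), (0, -1)} \<noteq> {}"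

definition quarter_walks :: "(int \<times> int) set \<Rightarrow> nat \<Rightarrow> nat \<Rightarrow> nat \<Rightarrow> (int \<times> int) list set" where
  "quarter_walks S i j n =
     {w. length w = n \<and> set w \<subseteq> S \<and>
         (\<forall>k\<le>n. fst (sum_list (take k w)) \<ge> 0 \<and> snd (sum_list (take k w)) \<ge> 0) \<and>
         sum_list w = (int i, int j)}"

definition walk_gf :: "(int \<times> int) set \<Rightarrow> real \<Rightarrow> complex \<Rightarrow> complex \<Rightarrow> complex" where
  "walk_gf S z x y =
     (\<Sum>\<^sub>\<infinity>(i, j, n)\<in>UNIV. of_nat (card (quarter_walks S i j n)) * x ^ i * y ^ j * of_real z ^ n)"

text \<open>
  The kernel $xyz(\sum_{(i,j)\in S} x^i y^j - 1/z)$ with the product multiplied out, so that it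
  has its polynomial value also at \<open>x = 0\<close> and \<open>y = 0\<close>.
\<close>

definition walk_kernel :: "(int \<times> int) set \<Rightarrow> real \<Rightarrow> 'a \<Rightarrow> 'a \<Rightarrow> 'a::real_normed_field" where
  "walk_kernel S z x y =
     of_real z * (\<Sum>(i, j)\<in>S. x ^ nat (i + 1) * y ^ nat (j + 1)) - x * y"


section \<open>Discriminants and branch points\<close>

definition step_ind :: "(int \<times> int) set \<Rightarrow> int \<Rightarrow> int \<Rightarrow> real" where
  "step_ind S i j = (if (i, j) \<in> S then 1 else 0)"

definition disc_x :: "(int \<times> int) set \<Rightarrow> real \<Rightarrow> real poly" where
  "disc_x S z =
     [: z * step_ind S (-1) 0, -1, z * step_ind S 1 0 :] ^ 2
     - smult (4 * z\<^sup>2)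
         ([: step_ind S (-1) 1, step_ind S 0 1, step_ind S 1 1 :] *
          [: step_ind S (-1) (-1), step_ind S 0 (-1), step_ind S 1 (-1) :])"

definition disc_y :: "(int \<times> int) set \<Rightarrow> real \<Rightarrow> real poly" where
  "disc_y S z = disc_x (prod.swap ` S) z"

text \<open>
  The four roots are real and numbered by increasing modulus, with the negative one first in case
  $|x_1| = |x_2|$ and last in case $|x_3| = |x_4|$; $x_4 = \infty$ if the discriminant has degree 3.
\<close>

definition branch_points :: "real poly \<Rightarrow> real \<Rightarrow> real \<Rightarrow> real \<Rightarrow> ereal \<Rightarrow> bool" where
  "branch_points d x1 x2 x3 x4 \<longleftrightarrow>
     poly d x1 = 0 \<and> poly d x2 = 0 \<and> poly d x3 = 0 \<and>
     (if degree d = 3 then x4 = \<infinity> else \<exists>x. x4 = ereal x \<and> poly d x = 0) \<and>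
     x1 \<noteq> x2 \<and> x4 \<noteq> ereal x3 \<and>
     \<bar>x1\<bar> \<le> x2 \<and> x2 < 1 \<and> 1 < x3 \<and> ereal x3 \<le> \<bar>x4\<bar>"

text \<open>
  The point $X(y)$ with $K(X(y),y) = 0$, used at the branch point $y = y_1$, where it is unique on
  the Riemann sphere. If there is no finite solution, then $X(y_1) = \infty$. In all models $X(y_1)$
  lies on the negative side of $x_1$, where $d > 0$, so that $\infty$ is represented by the lower
  integration bound \<open>-\<infinity>\<close>.
\<close>

definition kernel_root :: "(int \<times> int) set \<Rightarrow> real \<Rightarrow> real \<Rightarrow> ereal" where
  "kernel_root S z y =
     (if \<exists>x::real. walk_kernel S z x y = 0 then ereal (SOME x. walk_kernel S z x y = 0) else - \<infinity>)"


section \<open>Uniformization\<close>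

datatype riemann_sphere = Fin complex | Infty

definition period_lattice :: "complex \<Rightarrow> complex \<Rightarrow> complex set" where
  "period_lattice \<omega>1 \<omega>2 = {of_int m * \<omega>1 + of_int n * \<omega>2 | m n. True}"

definition weierstrass_p :: "complex \<Rightarrow> complex \<Rightarrow> complex \<Rightarrow> riemann_sphere" where
  "weierstrass_p \<omega>1 \<omega>2 \<omega> =
     (if \<omega> \<in> period_lattice \<omega>1 \<omega>2 then Infty
      else Fin (1 / \<omega>\<^sup>2 +
        (\<Sum>\<^sub>\<infinity>(m, n) \<in> UNIV - {(0, 0)}.
           1 / (\<omega> - (of_int m * \<omega>1 + of_int n * \<omega>2))\<^sup>2 - 1 / (of_int m * \<omega>1 + of_int n * \<omega>2)\<^sup>2)))"

text \<open>
  The Moebius transformation $g(t) = d''(x_4)/6 + d'(x_4)/(t - x_4)$, respectively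
  $g(t) = d''(0)/6 + d'''(0) t/6$ if $x_4 = \infty$, on the Riemann sphere.
\<close>

fun branch_moebius :: "real poly \<Rightarrow> ereal \<Rightarrow> riemann_sphere \<Rightarrow> riemann_sphere" where
  "branch_moebius d x4 (Fin t) =
     (if x4 = \<infinity> then
        Fin (of_real (poly ((pderiv ^^ 2) d) 0) / 6 + of_real (poly ((pderiv ^^ 3) d) 0) * t / 6)
      else if t = of_real (real_of_ereal x4) then Infty
      else
        Fin (of_real (poly ((pderiv ^^ 2) d) (real_of_ereal x4)) / 6 +
             of_real (poly (pderiv d) (real_of_ereal x4)) / (t - of_real (real_of_ereal x4))))"
| "branch_moebius d x4 Infty =
     (if x4 = \<infinity> then Infty else Fin (of_real (poly ((pderiv ^^ 2) d) (real_of_ereal x4)) / 6))"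

text \<open>
  $y(\omega) = g_y^{-1}(\wp(\omega - \omega_3/2))$, where \<open>d\<close> is the discriminant in \<open>y\<close>
  and \<open>y4\<close> its fourth branch point.
\<close>

definition y_unif ::
    "real poly \<Rightarrow> ereal \<Rightarrow> complex \<Rightarrow> complex \<Rightarrow> complex \<Rightarrow> complex \<Rightarrow> riemann_sphere" where
  "y_unif d y4 \<omega>1 \<omega>2 \<omega>3 \<omega> =
     inv (branch_moebius d y4) (weierstrass_p \<omega>1 \<omega>2 (\<omega> - \<omega>3 / 2))"


section \<open>Principal parts and parallelograms\<close>

definition principal_part :: "(complex \<Rightarrow> complex) \<Rightarrow> complex \<Rightarrow> complex \<Rightarrow> complex" where
  "principal_part f d \<omega> = poly (fls_prpart (laurent_expansion f d)) (1 / (\<omega> - d))"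

definition parallelogram :: "complex set \<Rightarrow> bool" where
  "parallelogram P \<longleftrightarrow>
     (\<exists>a u v. \<not> collinear {0, u, v} \<and> P = convex hull {a, a + u, a + v, a + u + v})"

definition symmetric_about :: "complex \<Rightarrow> complex set \<Rightarrow> bool" where
  "symmetric_about c P \<longleftrightarrow> (\<lambda>\<omega>. 2 * c - \<omega>) ` P = P"

end

theory Submission
  imports Defs
begin

text \<open>
  Write $c = \omega_{y_2}$ and subtract from $r$ its principal parts at the poles in $P_m$. The rest
  $h$ is holomorphic on $P_m$, and Cauchy's formula expresses $h(\omega) - h(c)$ as the integral over
  $\partial P_m$ of $r$ against the kernel
  $1/(\zeta-\omega) - 1/(\zeta-c) = \delta/(\zeta-c)^2 + \delta^2/((\zeta-\omega)(\zeta-c)^2)$ with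
  $\delta = \omega - c$; the principal parts do not contribute, since they decay at infinity.
  The first term of the kernel would only give a bounded integral, but it integrates to zero,
  because $r$ is even about $c$. The second term contributes $O(1/m)$, independently of the length of
  $\partial P_m$.

  That $r$ is even about $c$ needs to be known on the line $\Re\zeta = \Re c$ only, by the identity
  theorem. There $r$ is a function of $y$, and $y$ is even about $c$ because
  $\wp(\omega_1+\omega_2-u) = \wp(u)$. On the same line $r$ is bounded, so that $c$ is not a pole.
  The periodicity of $\wp$ requires $\omega_1$ and $\omega_2$ not to vanish, which rests on the
  signs of the discriminant between its branch points and on the convergence of the two integrals.
\<close>

section \<open>Contour integrals over parallelograms\<close>

text \<open>Non-collinearity makes the linear map w -> Re w * u + Im w * v injective. Followed by
  the translation by a, it carries the unit square onto the parallelogram, so path and image are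
  transported from \<open>rectpath\<close>. The orientation depends on that of u and v and stays
  open.\<close>

lemma parallelogram_boundary_path:
  fixes a u v :: complex
  assumes "\<not> collinear {0, u, v}"
  defines "g \<equiv> linepath a (a + u) +++ linepath (a + u) (a + u + v) +++
    linepath (a + u + v) (a + v) +++ linepath (a + v) a"
  shows "simple_path g"
    and "path_image g = frontier (convex hull {a, a + u, a + v, a + u + v})"
proof -
  define f where "f = (\<lambda>w. Re w *\<^sub>R u + Im w *\<^sub>R v)"
  have lin: "linear f"
    by (rule linearI) (auto simp: f_def algebra_simps)
  have inj: "inj f"
    unfolding linear_injective_0[OF lin]
  proof (intro allI impI)
    fix w assume "f w = 0"
    hence eq: "Re w *\<^sub>R u + Im w *\<^sub>R v = 0" by (simp add: f_def)
    show "w = 0"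
    proof (cases "Im w = 0")
      case True
      with eq assms(1) show ?thesis by (auto simp: complex_eq_iff collinear_lemma)
    next
      case False
      hence "v = (- Re w / Im w) *\<^sub>R u"
        using eq by (simp add: field_simps add_eq_0_iff scaleR_right.minus) 
          (metis (no_types, lifting) add.inverse_inverse divideR_right scaleR_left.minus scaleR_scaleR mult.commute divide_inverse)
      hence "collinear {0, u, v}" unfolding collinear_lemma by blast
      with assms(1) show ?thesis by blast
    qed
  qed
  have fl: "((+) a \<circ> f) \<circ> linepath p q = linepath (a + f p) (a + f q)" for p q
    by (auto simp: linepath_def fun_eq_iff f_def algebra_simps)
  have g: "g = (+) a \<circ> (f \<circ> rectpath 0 (Complex 1 1))"
    unfolding g_def rectpath_def Let_def comp_assoc[symmetric] path_compose_join fl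
    by (simp add: f_def algebra_simps)
  show "simple_path g"
    unfolding g simple_path_translation_eq simple_path_linear_image_eq[OF lin inj]
    by auto
  have box: "cbox 0 (Complex 1 1) = convex hull {0, 1, \<i>, Complex 1 1}"
  proof -
    have "{x::complex. \<forall>i\<in>Basis. x \<bullet> i = 0 \<or> x \<bullet> i = 1} = {0, 1, \<i>, Complex 1 1}"
      by (auto simp: Basis_complex_def complex_eq_iff)
    moreover have "(One::complex) = Complex 1 1" 
      by (simp add: Basis_complex_def complex_eq_iff)
    ultimately show ?thesis
      using unit_interval_convex_hull[where 'a = complex] by simp
  qed
  have hull: "convex hull {a, a + u, a + v, a + u + v} = (+) a ` f ` cbox 0 (Complex 1 1)"
    unfolding box convex_hull_linear_image[OF lin] convex_hull_translation[symmetric]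
    by (rule arg_cong[of _ _ "\<lambda>X. convex hull X"]) (auto simp: f_def algebra_simps)
  have "frontier ((+) a ` f ` cbox 0 (Complex 1 1)) = (+) a ` (f ` (cbox 0 (Complex 1 1) - box 0 (Complex 1 1)))"
    unfolding frontier_def closure_translation interior_translation
      closure_injective_linear_image[OF lin inj, symmetric] interior_injective_linear_image[OF lin inj]
    using inj by (simp add: image_set_diff inj_on_add)
  also have "\<dots> = path_image g"
    unfolding g path_image_compose
    by (subst path_image_rectpath_cbox_minus_box) auto
  finally show "path_image g = frontier (convex hull {a, a + u, a + v, a + u + v})"
    unfolding hull ..
qed

text \<open>The composition of the two reflections is the translation by 2 (c - b), whose iterates
  leave every bounded set unless b = c.\<close>

lemma symmetric_about_unique:
  fixes P :: "complex set"
  assumes "symmetric_about b P" "symmetric_about c P" "bounded P" "P \<noteq> {}"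
  shows "b = c"
proof (rule ccontr)
  assume ne: "b \<noteq> c"
  have step: "p + 2 * (c - b) \<in> P" if "p \<in> P" for p
  proof -
    have "2 * b - p \<in> P" using assms(1) that unfolding symmetric_about_def by blast
    hence "2 * c - (2 * b - p) \<in> P" using assms(2) unfolding symmetric_about_def by blast
    thus ?thesis by (simp add: algebra_simps)
  qed
  obtain p where p: "p \<in> P" using assms(4) by blast
  have iter: "p + of_nat n * (2 * (c - b)) \<in> P" for n
  proof (induction n)
    case (Suc n)
    from step[OF Suc.IH] show ?case by (simp add: algebra_simps)
  qed (simp add: p)
  obtain B where B: "\<And>x. x \<in> P \<Longrightarrow> norm x \<le> B" using assms(3) by (auto simp: bounded_iff)
  obtain n where n: "real n * norm (2 * (c - b)) > B + norm p"
    using ne reals_Archimedean3[of "norm (2 * (c - b))"] by fastforce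
  have "real n * norm (2 * (c - b)) = norm (of_nat n * (2 * (c - b)))"
    by (simp add: norm_mult)
  also have "\<dots> \<le> norm (p + of_nat n * (2 * (c - b))) + norm p"
    by (metis add_diff_cancel_left' norm_triangle_sub norm_triangle_ineq4)
  finally show False using B[OF iter[of n]] n by linarith
qed

text \<open>The reflection permutes the four vertices, and affine maps commute with convex
  hulls.\<close>

lemma symmetric_about_parallelogram_center:
  fixes a u v :: complex
  shows "symmetric_about (a + (u + v) / 2) (convex hull {a, a + u, a + v, a + u + v})"
proof -
  have eq: "(\<lambda>w. 2 * (a + (u + v) / 2) - w) = (\<lambda>w. (2 * a + u + v) + w) \<circ> (\<lambda>w. - w)"
    by (auto simp: algebra_simps fun_eq_iff)
  have "(\<lambda>w. 2 * (a + (u + v) / 2) - w) ` (convex hull {a, a + u, a + v, a + u + v})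
     = convex hull ((\<lambda>w. (2 * a + u + v) + w) ` uminus ` {a, a + u, a + v, a + u + v})"
    unfolding eq image_comp[symmetric]
    by (simp only: convex_hull_translation convex_hull_linear_image module_hom_uminus linear_uminus)
  also have "(\<lambda>w. (2 * a + u + v) + w) ` uminus ` {a, a + u, a + v, a + u + v} = {a, a + u, a + v, a + u + v}"
    by (auto simp: algebra_simps)
  finally show ?thesis by (simp add: symmetric_about_def)
qed

text \<open>The integrand decays at least quadratically at infinity, so its residues at d and w
  cancel once both points have the same winding number. The proof lowers the order of the pole at d
  by partial fractions.\<close>

lemma has_contour_integral_power_pole_0:
  assumes "valid_path g" "pathfinish g = pathstart g"
    and "d \<notin> path_image g" "w \<notin> path_image g" "w \<noteq> d"
    and "winding_number g d = winding_number g w"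
  shows "((\<lambda>x. 1 / (x - d) ^ Suc k * (1 / (x - w))) has_contour_integral 0) g"
proof (induction k)
  case 0
  have *: "((\<lambda>x. (1 / (x - w) - 1 / (x - d)) / (w - d)) has_contour_integral
      ((2 * pi * \<i> * winding_number g w - 2 * pi * \<i> * winding_number g d) / (w - d))) g"
    using assms by (intro has_contour_integral_div has_contour_integral_diff has_contour_integral_winding_number)
  show ?case
    by (rule has_contour_integral_eq[OF *[unfolded assms(6), simplified]])
       (use assms in \<open>auto simp: divide_simps\<close>)
next
  case (Suc k)
  \<comment> \<open>A pole of order at least two without residue has a primitive.\<close>
  have prim: "((\<lambda>x. 1 / (x - d) ^ Suc (Suc k)) has_contour_integral 0) g"
  proof (rule Cauchy_theorem_primitive)
    fix x assume x: "x \<in> - {d}"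
    show "((\<lambda>x. - 1 / (of_nat (Suc k) * (x - d) ^ Suc k)) has_field_derivative
        1 / (x - d) ^ Suc (Suc k)) (at x within - {d})"
      using x by (auto intro!: derivative_eq_intros simp: divide_simps power_Suc[symmetric] simp del: power_Suc of_nat_Suc)
        (simp add: algebra_simps)
  qed (use assms in auto)
  have *: "((\<lambda>x. (1 / (x - d) ^ Suc k * (1 / (x - w)) - 1 / (x - d) ^ Suc (Suc k)) / (w - d))
      has_contour_integral 0) g"
    using has_contour_integral_div[OF has_contour_integral_diff[OF Suc.IH prim], of "w - d"]
    unfolding diff_self div_0 .
  show ?case
  proof (rule has_contour_integral_eq[OF *])
    fix x assume "x \<in> path_image g"
    with assms have "x \<noteq> d" "x \<noteq> w" by auto
    thus "(1 / (x - d) ^ Suc k * (1 / (x - w)) - 1 / (x - d) ^ Suc (Suc k)) / (w - d)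
        = 1 / (x - d) ^ Suc (Suc k) * (1 / (x - w))"
      using assms(5) by (simp add: divide_simps)
  qed
qed

text \<open>The polynomial in 1 / (x - d) has no constant term, so only the powers of the preceding
  lemma occur. This is how principal parts drop out of Cauchy's formula.\<close>

lemma has_contour_integral_principal_part_0:
  assumes "valid_path g" "pathfinish g = pathstart g"
    and "d \<notin> path_image g" "w \<notin> path_image g" "w \<noteq> d"
    and "winding_number g d = winding_number g w"
  shows "((\<lambda>x. principal_part f d x / (x - w)) has_contour_integral 0) g"
proof -
  define p where "p = fls_prpart (laurent_expansion f d)"
  have c0: "coeff p 0 = 0" by (simp add: p_def)
  have "((\<lambda>x. \<Sum>i\<le>degree p. coeff p i * (1 / (x - d) ^ i * (1 / (x - w)))) has_contour_integral
      (\<Sum>i\<le>degree p. 0)) g"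
  proof (intro has_contour_integral_sum)
    fix i assume "i \<in> {..degree p}"
    show "((\<lambda>x. coeff p i * (1 / (x - d) ^ i * (1 / (x - w)))) has_contour_integral 0) g"
    proof (cases i)
      case (Suc k)
      thus ?thesis
        using has_contour_integral_lmul[OF has_contour_integral_power_pole_0[OF assms, of k], of "coeff p i"] by simp
    qed (simp add: c0 has_contour_integral_0)
  qed auto
  thus ?thesis
    by (simp add: principal_part_def p_def[symmetric] poly_altdef sum_divide_distrib power_divide)
qed

section \<open>Laurent expansions of principal parts\<close>

lemma principal_part_has_laurent_expansion:
  includes fps_syntax
  assumes "f meromorphic_on {d}"
  shows "(\<lambda>w. principal_part f d (d + w)) has_laurent_expansion
    fls_prpart_as_fls (laurent_expansion f d)"
proof -
  define F where "F = laurent_expansion f d"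
  define p where "p = fls_prpart F"
  have "(\<lambda>w. \<Sum>i\<le>degree p. coeff p i * inverse w ^ i) has_laurent_expansion
      (\<Sum>i\<le>degree p. fls_const (coeff p i) * fls_X_inv ^ i)"
    by (intro laurent_expansion_intros)
  also have "(\<Sum>i\<le>degree p. fls_const (coeff p i) * fls_X_inv ^ i) = fls_prpart_as_fls F"
  proof (rule fls_eqI)
    fix n :: int
    have X: "fls_X_inv ^ i = (fls_X_intpow (- int i) :: complex fls)" for i
      by (simp add: fls_X_inv_power_conv_shift_1)
    have "(\<Sum>i\<le>degree p. fls_const (coeff p i) * fls_X_inv ^ i) $$ n
        = (\<Sum>i\<le>degree p. if n = - int i then coeff p i else 0)"
      unfolding fls_nth_sum X by (intro sum.cong refl) auto
    \<comment> \<open>For n \<le> 0 the only matching index is \<open>nat (- n)\<close>. For n > 0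
      there is none, but \<open>nat (- n)\<close> is then 0, hence the guard in the summand.\<close>
    also have "\<dots> = (\<Sum>i\<le>degree p. if i = nat (- n) then (if n \<le> 0 then coeff p i else 0) else 0)"
      by (intro sum.cong refl) auto
    also have "\<dots> = (if n \<le> 0 then coeff p (nat (- n)) else 0)"
      by (auto simp: coeff_eq_0)
    \<comment> \<open>At n = 0 both sides vanish, the polynomial having no constant term.\<close>
    also have "\<dots> = fls_prpart_as_fls F $$ n"
      unfolding fls_prpart_as_fls_nth by (auto simp: p_def)
    finally show "(\<Sum>i\<le>degree p. fls_const (coeff p i) * fls_X_inv ^ i) $$ n = fls_prpart_as_fls F $$ n" .
  qed
  also have "(\<lambda>w. \<Sum>i\<le>degree p. coeff p i * inverse w ^ i) = (\<lambda>w. principal_part f d (d + w))"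
    by (simp add: principal_part_def F_def p_def poly_altdef inverse_eq_divide)
  finally show ?thesis by (simp add: F_def)
qed

lemma principal_part_analytic: "w \<noteq> d \<Longrightarrow> principal_part f d analytic_on {w}"
  unfolding principal_part_def[abs_def] poly_altdef by (intro analytic_intros) auto

lemma principal_part_meromorphic: "f meromorphic_on {d} \<Longrightarrow> principal_part f d meromorphic_on A"
  unfolding principal_part_def[abs_def] poly_altdef by (intro meromorphic_intros)

text \<open>A pole would give the Laurent series of the difference a negative order, but all its
  coefficients of negative index cancel.\<close>

lemma not_is_pole_diff_principal_part:
  includes fps_syntax
  assumes "f meromorphic_on {d}"
  shows "\<not> is_pole (\<lambda>w. f w - principal_part f d w) d"
proof
  assume pole: "is_pole (\<lambda>w. f w - principal_part f d w) d"
  define F where "F = laurent_expansion f d"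
  have "(\<lambda>w. f (d + w) - principal_part f d (d + w)) has_laurent_expansion (F - fls_prpart_as_fls F)"
    unfolding F_def
    by (intro has_laurent_expansion_diff principal_part_has_laurent_expansion assms
        meromorphic_on_imp_has_laurent_expansion[OF assms]) auto
  from is_pole_imp_neg_fls_subdegree[OF this pole]
  have neg: "fls_subdegree (F - fls_prpart_as_fls F) < 0" .
  hence "F - fls_prpart_as_fls F \<noteq> 0" by auto
  hence "(F - fls_prpart_as_fls F) $$ fls_subdegree (F - fls_prpart_as_fls F) \<noteq> 0"
    by (rule nth_fls_subdegree_nonzero)
  thus False using neg unfolding fls_minus_nth fls_prpart_as_fls_nth by simp
qed

text \<open>The bound is independent of the length of the segment: 1 / |x - c|^2 is at most 2 /
  (\<rho>^2 + s^2), where s is the distance from the foot of the perpendicular, and this has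
  integral 2 pi / \<rho> over the whole line.\<close>

lemma norm_contour_integral_linepath_le:
  fixes f :: "complex \<Rightarrow> complex"
  assumes I: "(f has_contour_integral I) (linepath a b)"
    and rho: "\<rho> > 0" and B: "B \<ge> 0"
    and dist: "\<And>x. x \<in> closed_segment a b \<Longrightarrow> \<rho> \<le> norm (x - c)"
    and bound: "\<And>x. x \<in> closed_segment a b \<Longrightarrow> norm (f x) \<le> B / norm (x - c) ^ 2"
  shows "norm I \<le> 2 * pi * B / \<rho>"
proof (cases "a = b")
  case True
  with I have "I = 0" by (simp add: has_contour_integral_trivial_iff)
  with rho B show ?thesis by simp
next
  case False
  define L where "L = norm (b - a)"
  \<comment> \<open>Parameter of the foot of the perpendicular from c to the line through a and
    b.\<close>
  define t0 where "t0 = - Re ((a - c) * cnj (b - a)) / L ^ 2"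
  define g where "g = (\<lambda>t. 2 * B * L / (\<rho> ^ 2 + (L * (t - t0)) ^ 2))"
  define G where "G = (\<lambda>t. 2 * B / \<rho> * arctan (L * (t - t0) / \<rho>))"
  have L: "L > 0" using False by (simp add: L_def)
  have den: "\<rho> ^ 2 + (L * (t - t0)) ^ 2 > 0" for t using rho by (simp add: add_pos_nonneg)
  have le: "norm (f (linepath a b t) * (b - a)) \<le> g t" if t: "t \<in> {0..1}" for t
  proof -
    define x where "x = linepath a b t"
    have x: "x \<in> closed_segment a b" using t linepath_image_01[of a b] by (auto simp: x_def)
    have xc: "x - c = (a - c) + of_real t * (b - a)"
      by (simp add: x_def linepath_def scaleR_conv_of_real algebra_simps)
    have "Re ((x - c) * cnj (b - a)) = Re ((a - c) * cnj (b - a)) + Re (of_real t * ((b - a) * cnj (b - a)))"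
      unfolding xc by (simp add: algebra_simps)
    also have "(b - a) * cnj (b - a) = of_real (L ^ 2)"
      unfolding L_def by (rule complex_norm_square[symmetric])
    also have "Re ((a - c) * cnj (b - a)) = - t0 * L ^ 2" using L by (simp add: t0_def)
    finally have "L ^ 2 * (t - t0) = Re ((x - c) * cnj (b - a))" by (simp add: algebra_simps)
    hence "L ^ 2 * \<bar>t - t0\<bar> \<le> norm ((x - c) * cnj (b - a))"
      using abs_Re_le_cmod[of "(x - c) * cnj (b - a)"] by (simp add: abs_mult[symmetric] flip: abs_mult)
    hence "L * (L * \<bar>t - t0\<bar>) \<le> L * norm (x - c)"
      by (simp add: norm_mult L_def power2_eq_square mult_ac norm_minus_commute flip: complex_cnj_diff)
    hence "L * \<bar>t - t0\<bar> \<le> norm (x - c)" using L by simp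
    hence "(L * \<bar>t - t0\<bar>) ^ 2 \<le> norm (x - c) ^ 2" using L by (intro power_mono) auto
    moreover have "\<rho> ^ 2 \<le> norm (x - c) ^ 2" using dist[OF x] rho by (intro power_mono) auto
    \<comment> \<open>Both \<rho> and the distance from the foot are at most |x - c|, which explains
      the factor 2 in \<open>g\<close>.\<close>
    ultimately have *: "\<rho> ^ 2 + (L * (t - t0)) ^ 2 \<le> 2 * norm (x - c) ^ 2"
      by (simp add: power_mult_distrib)
    have pos: "norm (x - c) > 0" using dist[OF x] rho by linarith
    have "norm (f x * (b - a)) \<le> B / norm (x - c) ^ 2 * L"
      unfolding norm_mult L_def[symmetric] using bound[OF x] L by (intro mult_right_mono) auto
    also have "\<dots> = 2 * B * L / (2 * norm (x - c) ^ 2)" by simp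
    also have "\<dots> \<le> g t" unfolding g_def using * den[of t] B L pos
      by (intro divide_left_mono mult_pos_pos) auto
    finally show ?thesis by (simp add: x_def)
  qed
  have "(g has_integral (G 1 - G 0)) {0..1}"
  proof (rule fundamental_theorem_of_calculus)
    fix t :: real
    have eq: "1 + (L * (t - t0) / \<rho>) ^ 2 = (\<rho> ^ 2 + (L * (t - t0)) ^ 2) / \<rho> ^ 2"
      using rho by (simp add: divide_simps)
    have "(G has_real_derivative 2 * B / \<rho> * (L / \<rho> * inverse (1 + (L * (t - t0) / \<rho>) ^ 2))) (at t within {0..1})"
      unfolding G_def using rho by (auto intro!: derivative_eq_intros simp: divide_simps)
    also have "2 * B / \<rho> * (L / \<rho> * inverse (1 + (L * (t - t0) / \<rho>) ^ 2)) = g t"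
      unfolding eq g_def using rho den[of t] by (simp add: field_simps power2_eq_square)
    finally show "(G has_vector_derivative g t) (at t within {0..1})"
      by (simp add: has_real_derivative_iff_has_vector_derivative)
  qed simp
  hence "norm I \<le> G 1 - G 0"
    using I le unfolding has_contour_integral_linepath
    by (metis (no_types, lifting) integral_norm_bound_integral has_integral_integrable integral_unique)
  also have "\<dots> = 2 * B / \<rho> * (arctan (L * (1 - t0) / \<rho>) - arctan (L * (0 - t0) / \<rho>))"
    by (simp add: G_def right_diff_distrib)
  also have "\<dots> \<le> 2 * B / \<rho> * pi"
    using arctan_ubound[of "L * (1 - t0) / \<rho>"] arctan_lbound[of "L * (0 - t0) / \<rho>"] rho B
    by (intro mult_left_mono) auto
  finally show ?thesis by (simp add: mult_ac)
qed

text \<open>The reflection preserves the integrand on the segment and reverses the line element,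
  hence the sign.\<close>

lemma has_contour_integral_linepath_reflect:
  assumes "(f has_contour_integral i) (linepath p q)"
    and "\<And>x. x \<in> closed_segment p q \<Longrightarrow> f (2 * c - x) = f x"
  shows "(f has_contour_integral (- i)) (linepath (2 * c - p) (2 * c - q))"
proof -
  have "((\<lambda>x. - (f (linepath p q x) * (q - p))) has_integral (- i)) {0..1}"
    using assms(1) by (intro has_integral_neg) (simp add: has_contour_integral_linepath)
  moreover have "f (linepath (2 * c - p) (2 * c - q) x) * ((2 * c - q) - (2 * c - p)) =
      - (f (linepath p q x) * (q - p))" if "x \<in> {0..1}" for x
  proof -
    have "linepath (2 * c - p) (2 * c - q) x = 2 * c - linepath p q x"
      by (simp add: linepath_def scaleR_conv_of_real algebra_simps)
    moreover have "linepath p q x \<in> closed_segment p q" using that linepath_image_01[of p q] by auto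
    ultimately show ?thesis using assms(2)[of "linepath p q x"] by (simp add: left_diff_distrib right_diff_distrib)
  qed
  ultimately show ?thesis unfolding has_contour_integral_linepath
    by (metis (no_types, lifting) has_integral_cong)
qed

text \<open>At a pole the modulus tends to infinity along every approach, so a bound on any set
  accumulating at x suffices. Such sets are the boundary of a parallelogram and a vertical
  line.\<close>

lemma not_is_pole_if_bounded:
  assumes "x islimpt T" "\<And>w. w \<in> T \<Longrightarrow> norm (f w) \<le> B"
  shows "\<not> is_pole f x"
proof
  assume "is_pole f x"
  hence "filterlim (\<lambda>w. norm (f w)) at_top (at x)"
    unfolding is_pole_def filterlim_at_infinity_conv_norm_at_top .
  hence "\<forall>\<^sub>F w in at x. norm (f w) > B" by (simp add: filterlim_at_top_dense)
  moreover have "\<exists>\<^sub>F w in at x. w \<in> T" using assms(1) by (simp add: islimpt_conv_frequently_at)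
  ultimately have "\<exists>\<^sub>F w in at x. w \<in> T \<and> norm (f w) > B"
    by (simp add: frequently_eventually_frequently)
  then obtain w where "w \<in> T" "norm (f w) > B" by (auto dest: frequently_ex)
  with assms(2) show False by fastforce
qed

text \<open>Identity theorem for w -> r (2 c - w) - r w, which vanishes on a set accumulating at c.
  Removing its singularities makes the theorem applicable; at x the difference is analytic, so
  nothing changes there.\<close>

lemma meromorphic_reflect_eq:
  assumes r: "r nicely_meromorphic_on UNIV"
    and "c islimpt T" "\<And>w. w \<in> T \<Longrightarrow> r (2 * c - w) = r w"
    and "\<not> is_pole r x" "\<not> is_pole r (2 * c - x)"
  shows "r (2 * c - x) = r x"
proof -
  define g where "g = (\<lambda>w. r (2 * c - w) - r w)"
  have mero: "r meromorphic_on UNIV" using r by (simp add: nicely_meromorphic_on_def)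
  have gm: "g meromorphic_on UNIV" unfolding g_def
    by (intro meromorphic_on_diff mero meromorphic_on_compose[OF mero]) (auto intro!: analytic_intros)
  have "\<exists>\<^sub>F w in at c. w \<in> T" using assms(2) by (simp add: islimpt_conv_frequently_at)
  moreover have "\<forall>\<^sub>F w in at c. remove_sings g w = g w"
    using eventually_remove_sings_eq[OF gm] by (simp add: eventually_cosparse_open_eq)
  ultimately have "\<exists>\<^sub>F w in at c. w \<in> T \<and> remove_sings g w = g w"
    by (simp add: frequently_eventually_frequently)
  hence freq: "\<exists>\<^sub>F w in at c. remove_sings g w = 0"
    by (rule frequently_elim1) (auto simp: g_def assms(3))
  have "remove_sings g x = 0"
    by (rule frequently_eq_meromorphic_imp_constant[OF freq remove_sings_nicely_meromorphic[OF gm]]) auto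
  moreover have "g analytic_on {x}"
  proof -
    have "r analytic_on {2 * c - x}" "r analytic_on {x}"
      using assms(4,5) by (auto intro!: nicely_meromorphic_on_imp_analytic_at[OF r])
    moreover have "(r \<circ> (\<lambda>w. 2 * c - w)) analytic_on {x}"
      by (rule analytic_on_compose) (use calculation in \<open>auto intro!: analytic_intros\<close>)
    ultimately show ?thesis unfolding g_def by (intro analytic_on_diff) (auto simp: o_def)
  qed
  ultimately show ?thesis by (simp add: g_def)
qed

text \<open>The condition 2 |w - c| < \<rho> puts w inside P, at distance at least \<rho> / 2 from
  the boundary. The 8 comes from four sides, each contributing at most 2 pi * 2 M |w - c|^2 /
  \<rho>^2, after division by the 2 pi of Cauchy's formula. For M and \<rho> of order m the bound is
  O(1/m).\<close>

lemma parallelogram_partial_fraction_estimate: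
  assumes r: "r nicely_meromorphic_on UNIV"
    and P: "parallelogram P" "symmetric_about c P"
    and even: "\<And>x. \<not> is_pole r x \<Longrightarrow> \<not> is_pole r (2 * c - x) \<Longrightarrow> r (2 * c - x) = r x"
    and np: "\<not> is_pole r c" "\<not> is_pole r w"
    and M: "\<And>x. x \<in> frontier P \<Longrightarrow> norm (r x) \<le> M"
    and rho: "\<And>x. x \<in> frontier P \<Longrightarrow> \<rho> \<le> norm (x - c)" "2 * norm (w - c) < \<rho>"
  shows "norm (r w - r c - (\<Sum>d\<in>{d \<in> P. is_pole r d}. principal_part r d w - principal_part r d c))
    \<le> 8 * M * norm (w - c) ^ 2 / \<rho> ^ 2"
proof -
  obtain a u v where uv: "\<not> collinear {0, u, v}" and P_eq: "P = convex hull {a, a + u, a + v, a + u + v}"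
    using P(1) unfolding parallelogram_def by blast
  define g where "g = linepath a (a + u) +++ linepath (a + u) (a + u + v) +++
    linepath (a + u + v) (a + v) +++ linepath (a + v) a"
  have simple: "simple_path g" and img: "path_image g = frontier P"
    using parallelogram_boundary_path[OF uv, of a] unfolding g_def P_eq by auto
  have valid: "valid_path g" and loop: "pathfinish g = pathstart g"
    by (auto simp: g_def)
  have conv: "convex P" and comp: "compact P"
    unfolding P_eq by (simp_all add: compact_convex_hull finite_imp_compact)
  hence bdd: "bounded P" and clo: "closed P" by (auto intro: compact_imp_bounded compact_imp_closed)
  \<comment> \<open>By uniqueness, the prescribed centre is the intersection of the
    diagonals.\<close>
  have center: "c = a + (u + v) / 2"
    by (rule symmetric_about_unique[OF P(2) _ bdd]) (auto simp: P_eq symmetric_about_parallelogram_center)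
  have two_c: "2 * c = 2 * a + u + v" by (simp add: center algebra_simps add_divide_distrib)
  have corners: "a + u + v = 2 * c - a" "a + v = 2 * c - (a + u)" unfolding two_c by simp_all
  have rho_pos: "\<rho> > 0" using rho(2) norm_ge_zero[of "w - c"] by linarith
  have "a \<in> P" "a + u + v \<in> P" unfolding P_eq by (auto intro: hull_inc)
  hence "midpoint a (a + u + v) \<in> P"
    using closed_segment_subset[OF _ _ conv] midpoint_in_closed_segment by blast
  hence cP: "c \<in> P" by (simp add: center midpoint_def scaleR_conv_of_real field_simps)
  \<comment> \<open>A disc is connected; missing the frontier of P and containing a point of P, it
    stays in P.\<close>
  have ball: "ball c \<rho> \<subseteq> interior P"
  proof -
    have "ball c \<rho> \<inter> frontier P = {}"
      using rho(1) by (force simp: dist_norm norm_minus_commute)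
    moreover have "ball c \<rho> \<inter> P \<noteq> {}" using cP rho_pos centre_in_ball by blast
    ultimately have "ball c \<rho> - P = {}"
      using connected_Int_frontier[of "ball c \<rho>" P] by auto
    thus ?thesis by (intro interior_maximal) auto
  qed
  have "norm (w - c) < \<rho>" using rho(2) norm_ge_zero[of "w - c"] by linarith
  hence wint: "w \<in> interior P" using ball by (auto simp: dist_norm norm_minus_commute)
  have cint: "c \<in> interior P" using ball rho_pos by auto
  have front: "frontier P \<subseteq> P" "frontier P \<inter> interior P = {}"
    using clo by (auto simp: frontier_def)
  \<comment> \<open>The boundary is connected and not a single point, so each of its points is a
    limit point of it, and the bound \<open>M\<close> excludes poles there.\<close>
  have no_pole: "\<not> is_pole r x" if x: "x \<in> frontier P" for x
  proof (rule not_is_pole_if_bounded[OF _ M])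
    show "x islimpt frontier P" unfolding img[symmetric]
    proof (rule connected_imp_perfect)
      show "connected (path_image g)" using simple by (simp add: connected_simple_path_image)
      show "path_image g \<noteq> {y}" for y
        using simple_path_image_uncountable[OF simple] by (metis countable_empty countable_insert)
      show "x \<in> path_image g" using x img by simp
    qed
  qed
  have r_an: "r analytic_on {x}" if "\<not> is_pole r x" for x
    by (rule nicely_meromorphic_on_imp_analytic_at[OF r]) (use that in auto)
  have mero: "r meromorphic_on UNIV" using r by (simp add: nicely_meromorphic_on_def)

  \<comment> \<open>Removal of the poles inside the parallelogram\<close>
  define D where "D = {d \<in> P. is_pole r d}"
  have finD: "finite D"
  proof -
    have "{x. \<not> r analytic_on {x}} sparse_in P"
      by (rule meromorphic_on_imp_sparse_singularities) (rule meromorphic_on_subset[OF mero], simp)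
    hence "finite (P \<inter> {x. \<not> r analytic_on {x}})" by (rule sparse_in_compact_finite[OF _ comp])
    moreover have "D \<subseteq> P \<inter> {x. \<not> r analytic_on {x}}"
      unfolding D_def using analytic_at_imp_no_pole by blast
    ultimately show ?thesis by (rule rev_finite_subset)
  qed
  define h0 where "h0 = (\<lambda>x. r x - (\<Sum>d\<in>D. principal_part r d x))"
  \<comment> \<open>At a pole of \<open>r\<close> the value of \<open>h0\<close> rests on
    conventions; \<open>remove_sings\<close> replaces it by the limit.\<close>
  define h where "h = remove_sings h0"
  have pp_mero: "principal_part r d meromorphic_on UNIV" for d
    using meromorphic_on_subset[OF mero] by (intro principal_part_meromorphic) auto
  have h0_mero: "h0 meromorphic_on UNIV" unfolding h0_def
    by (intro meromorphic_on_diff meromorphic_on_sum mero pp_mero)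
  have h0_an: "h0 analytic_on {x}" if "\<not> is_pole r x" for x
    unfolding h0_def using that
    by (intro analytic_on_diff r_an analytic_on_sum principal_part_analytic) (auto simp: D_def)
  have h_eq: "h x = h0 x" if "\<not> is_pole r x" for x
    unfolding h_def by (rule remove_sings_at_analytic[OF h0_an[OF that]])
  have h0_np: "\<not> is_pole h0 x" if x: "x \<in> P" for x
  proof (cases "x \<in> D")
    case False
    with x have "h0 analytic_on {x}" by (intro h0_an) (auto simp: D_def)
    thus ?thesis by (rule analytic_at_imp_no_pole)
  next
    case True
    \<comment> \<open>Only the principal part at x itself is singular at x; the others are analytic
      there.\<close>
    let ?f = "\<lambda>w. r w - principal_part r x w" and ?s = "\<lambda>w. \<Sum>d\<in>D - {x}. principal_part r d w"
    have "?f meromorphic_on {x}"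
      by (intro meromorphic_on_diff meromorphic_on_subset[OF mero] meromorphic_on_subset[OF pp_mero]) auto
    hence "not_essential ?f x" by (rule meromorphic_on_not_essential)
    moreover have "\<not> is_pole ?f x"
      by (rule not_is_pole_diff_principal_part) (rule meromorphic_on_subset[OF mero], simp)
    ultimately obtain l where l: "?f \<midarrow>x\<rightarrow> l" unfolding not_essential_def by blast
    have "?s analytic_on {x}" by (intro analytic_on_sum principal_part_analytic) auto
    hence "?s \<midarrow>x\<rightarrow> ?s x" using analytic_at_imp_isCont isContD by blast
    with l have "(\<lambda>w. ?f w - ?s w) \<midarrow>x\<rightarrow> l - ?s x" by (rule tendsto_diff)
    also have "(\<lambda>w. ?f w - ?s w) = h0"
      unfolding h0_def by (subst sum.remove[OF finD True]) (simp add: algebra_simps)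
    finally show ?thesis
      unfolding is_pole_def using not_tendsto_and_filterlim_at_infinity[of "at x" h0] by auto
  qed
  have h_an: "h analytic_on {x}" if x: "x \<in> P" for x
  proof (rule nicely_meromorphic_on_imp_analytic_at[of h UNIV])
    show "h nicely_meromorphic_on UNIV"
      unfolding h_def using h0_mero by (rule remove_sings_nicely_meromorphic)
    have "isolated_singularity_at h0 x" 
      by (rule meromorphic_on_isolated_singularity) (rule meromorphic_on_subset[OF h0_mero], simp)
    thus "\<not> is_pole h x" unfolding h_def using h0_np[OF x] by simp
  qed simp
  have h_holo: "h holomorphic_on P"
    by (rule analytic_imp_holomorphic, subst analytic_on_analytic_at) (use h_an in blast)
  have inside: "inside (path_image g) = interior P"
    unfolding img by (rule inside_frontier_eq_interior[OF bdd conv])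
  \<comment> \<open>The direction in which \<open>g\<close> runs around P is not known, so the
    winding number is 1 or -1. Only its modulus enters the bound.\<close>
  obtain s :: complex where s: "\<And>x. x \<in> interior P \<Longrightarrow> winding_number g x = s" "norm s = 1"
  proof (rule simple_closed_path_winding_number_inside[OF simple])
    assume "\<And>x. x \<in> inside (path_image g) \<Longrightarrow> winding_number g x = 1"
    thus thesis using that[of 1] inside by auto
  next
    assume "\<And>x. x \<in> inside (path_image g) \<Longrightarrow> winding_number g x = -1"
    thus thesis using that[of "-1"] inside by auto
  qed
  have Dint: "d \<in> interior P" if "d \<in> D" for d
    using that no_pole clo by (auto simp: D_def frontier_def)
  \<comment> \<open>On the boundary \<open>h\<close> and \<open>r\<close> differ by principal parts,
    whose integrals against the Cauchy kernel vanish. Cauchy's formula for \<open>h\<close> can thus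
    be written with \<open>r\<close>.\<close>
  have cauchy: "((\<lambda>x. r x / (x - z)) has_contour_integral (2 * pi * \<i> * s * h z)) g"
    if z: "z \<in> interior P" "\<not> is_pole r z" for z
  proof -
    have "((\<lambda>x. h x / (x - z)) has_contour_integral (2 * pi * \<i> * winding_number g z * h z)) g"
      by (rule Cauchy_integral_formula_convex_simple[OF conv h_holo z(1) valid _ loop])
         (use front z(1) img in auto)
    moreover have "((\<lambda>x. \<Sum>d\<in>D. principal_part r d x / (x - z)) has_contour_integral (\<Sum>d\<in>D. 0)) g"
    proof (intro has_contour_integral_sum finD has_contour_integral_principal_part_0 valid loop)
      fix d assume d: "d \<in> D"
      show "d \<notin> path_image g" "z \<notin> path_image g" using Dint[OF d] z(1) front img by auto
      show "z \<noteq> d" using d z(2) by (auto simp: D_def)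
      show "winding_number g d = winding_number g z" using s(1) Dint[OF d] z(1) by simp
    qed
    ultimately have "((\<lambda>x. h x / (x - z) + (\<Sum>d\<in>D. principal_part r d x / (x - z)))
        has_contour_integral (2 * pi * \<i> * winding_number g z * h z + (\<Sum>d\<in>D. 0))) g"
      by (rule has_contour_integral_add)
    hence "((\<lambda>x. h x / (x - z) + (\<Sum>d\<in>D. principal_part r d x / (x - z)))
        has_contour_integral (2 * pi * \<i> * s * h z)) g"
      by (simp only: s(1)[OF z(1)] sum.neutral_const add_0_right)
    thus ?thesis
    proof (rule has_contour_integral_eq)
      fix x assume "x \<in> path_image g"
      hence "\<not> is_pole r x" using no_pole img by simp
      thus "h x / (x - z) + (\<Sum>d\<in>D. principal_part r d x / (x - z)) = r x / (x - z)"
        by (simp add: h_eq h0_def diff_divide_distrib sum_divide_distrib)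
    qed
  qed

  \<comment> \<open>Splitting of the difference of two Cauchy kernels\<close>
  define \<delta> where "\<delta> = w - c"
  define f1 where "f1 = (\<lambda>x. r x * \<delta> / (x - c) ^ 2)"
  define f2 where "f2 = (\<lambda>x. r x * \<delta> ^ 2 / ((x - w) * (x - c) ^ 2))"
  have ne: "x \<noteq> c" "x \<noteq> w" if "x \<in> frontier P" for x using that front cint wint by auto
  have total: "((\<lambda>x. f1 x + f2 x) has_contour_integral (2 * pi * \<i> * s * (h w - h c))) g"
  proof (rule has_contour_integral_eq)
    show "((\<lambda>x. r x / (x - w) - r x / (x - c)) has_contour_integral (2 * pi * \<i> * s * (h w - h c))) g"
      using has_contour_integral_diff[OF cauchy[OF wint np(2)] cauchy[OF cint np(1)]]
      by (simp add: algebra_simps)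
    fix x assume "x \<in> path_image g"
    hence "x - w \<noteq> 0" "x - c \<noteq> 0" using ne img by auto
    moreover have "\<delta> = (x - c) - (x - w)" by (simp add: \<delta>_def)
    ultimately show "r x / (x - w) - r x / (x - c) = f1 x + f2 x"
      unfolding f1_def f2_def by (simp add: divide_simps power2_eq_square) (simp add: algebra_simps)
  qed
  have r_cont: "continuous_on (frontier P) r"
    by (rule holomorphic_on_imp_continuous_on, rule analytic_imp_holomorphic, subst analytic_on_analytic_at)
       (use r_an no_pole in blast)
  have f_cont: "continuous_on (frontier P) f1" "continuous_on (frontier P) f2"
    unfolding f1_def f2_def using ne by (auto intro!: continuous_intros r_cont)
  \<comment> \<open>The directed sides. Reflection about c permutes this set, start points going to
    start points, and so pairs opposite sides.\<close>
  define Q where "Q = {(a, a + u), (a + u, a + u + v), (a + u + v, a + v), (a + v, a)}"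
  have seg: "closed_segment p q \<subseteq> frontier P" if "(p, q) \<in> Q" for p q
    using that unfolding img[symmetric] g_def Q_def by (auto simp: path_image_join)
  have int: "f contour_integrable_on linepath p q" if "(p, q) \<in> Q" "continuous_on (frontier P) f" for p q f
    by (rule contour_integrable_continuous_linepath) (rule continuous_on_subset[OF that(2) seg[OF that(1)]])
  have split: "(f has_contour_integral
      (contour_integral (linepath a (a + u)) f + (contour_integral (linepath (a + u) (a + u + v)) f +
      (contour_integral (linepath (a + u + v) (a + v)) f + contour_integral (linepath (a + v) a) f)))) g"
    if "continuous_on (frontier P) f" for f
    unfolding g_def
    by (intro has_contour_integral_join has_contour_integral_integral int that valid_path_join) (auto simp: Q_def)
  have even1: "f1 (2 * c - x) = f1 x" if x: "x \<in> closed_segment p q" "(p, q) \<in> Q" for x p q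
  proof -
    have "x \<in> frontier P" using seg x by blast
    moreover have "2 * c - x \<in> frontier P"
    proof -
      have "2 * c - x \<in> closed_segment (2 * c - p) (2 * c - q)"
      proof -
        obtain t where t: "0 \<le> t" "t \<le> 1" "x = (1 - t) *\<^sub>R p + t *\<^sub>R q"
          using x(1) unfolding closed_segment_def by blast
        have "2 * c - x = (1 - t) *\<^sub>R (2 * c - p) + t *\<^sub>R (2 * c - q)"
          unfolding t(3) by (simp add: scaleR_conv_of_real algebra_simps)
        thus ?thesis using t(1,2) unfolding closed_segment_def by blast
      qed
      moreover have "(2 * c - p, 2 * c - q) \<in> Q"
        using x(2) by (auto simp: Q_def two_c)
      ultimately show ?thesis using seg by blast
    qed
    ultimately have "r (2 * c - x) = r x" using even no_pole by blast
    moreover have "(2 * c - x - c) ^ 2 = (x - c) ^ 2" by (simp add: power2_commute)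
    ultimately show ?thesis by (simp add: f1_def)
  qed
  have refl: "contour_integral (linepath (2 * c - p) (2 * c - q)) f1 = - contour_integral (linepath p q) f1"
    if "(p, q) \<in> Q" for p q
    by (rule contour_integral_unique, rule has_contour_integral_linepath_reflect)
       (use has_contour_integral_integral[OF int[OF that f_cont(1)]] even1[OF _ that] in auto)
  \<comment> \<open>Since \<open>f1\<close> is even about c on the boundary, opposite sides
    cancel.\<close>
  have "contour_integral (linepath (a + u + v) (a + v)) f1 = - contour_integral (linepath a (a + u)) f1"
    using refl[of a "a + u"] unfolding corners by (simp add: Q_def)
  moreover have "contour_integral (linepath (a + v) a) f1 = - contour_integral (linepath (a + u) (a + u + v)) f1"
    using refl[of "a + u" "a + u + v"] unfolding corners by (simp add: Q_def corners)
  ultimately have f1_int: "(f1 has_contour_integral 0) g"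
    using split[OF f_cont(1)] by simp
  have f2_int: "(f2 has_contour_integral (2 * pi * \<i> * s * (h w - h c))) g"
    using has_contour_integral_diff[OF total f1_int] by simp
  have f2_seg: "norm (contour_integral (linepath p q) f2) \<le> 2 * pi * (2 * M * norm \<delta> ^ 2 / \<rho>) / \<rho>"
    if pq: "(p, q) \<in> Q" for p q
  proof (rule norm_contour_integral_linepath_le[where c = c])
    show "(f2 has_contour_integral contour_integral (linepath p q) f2) (linepath p q)"
      by (rule has_contour_integral_integral[OF int[OF pq f_cont(2)]])
    have "p \<in> frontier P" using seg[OF pq] by auto
    hence "M \<ge> 0" using M norm_ge_zero order_trans by blast
    thus "0 \<le> 2 * M * norm \<delta> ^ 2 / \<rho>" using rho_pos by simp
    fix x assume "x \<in> closed_segment p q"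
    hence x: "x \<in> frontier P" using seg[OF pq] by blast
    show "\<rho> \<le> norm (x - c)" by (rule rho(1)[OF x])
    have "norm (x - c) \<le> norm (x - w) + norm (w - c)" using norm_triangle_ineq[of "x - w" "w - c"] by simp
    hence xw: "\<rho> / 2 \<le> norm (x - w)" using rho(1)[OF x] rho(2) by linarith
    have xc: "norm (x - c) > 0" using rho(1)[OF x] rho_pos by linarith
    have "norm (f2 x) = norm (r x) * norm \<delta> ^ 2 / (norm (x - w) * norm (x - c) ^ 2)"
      by (simp add: f2_def norm_mult norm_divide norm_power)
    also have "\<dots> \<le> M * norm \<delta> ^ 2 / (\<rho> / 2 * norm (x - c) ^ 2)"
      using M[OF x] xw xc rho_pos \<open>M \<ge> 0\<close> by (intro frac_le mult_right_mono) auto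
    also have "\<dots> = 2 * M * norm \<delta> ^ 2 / \<rho> / norm (x - c) ^ 2" using rho_pos xc by (simp add: field_simps)
    finally show "norm (f2 x) \<le> 2 * M * norm \<delta> ^ 2 / \<rho> / norm (x - c) ^ 2" .
  qed (rule rho_pos)
  have "norm (2 * pi * \<i> * s * (h w - h c)) \<le> 4 * (2 * pi * (2 * M * norm \<delta> ^ 2 / \<rho>) / \<rho>)"
  proof -
    let ?B = "2 * pi * (2 * M * norm \<delta> ^ 2 / \<rho>) / \<rho>"
    have "2 * pi * \<i> * s * (h w - h c) = contour_integral (linepath a (a + u)) f2 + (contour_integral (linepath (a + u) (a + u + v)) f2 +
      (contour_integral (linepath (a + u + v) (a + v)) f2 + contour_integral (linepath (a + v) a) f2))"
      by (rule has_contour_integral_unique[OF f2_int split[OF f_cont(2)]])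
    also have "norm \<dots> \<le> ?B + (?B + (?B + ?B))"
      by (intro norm_triangle_le add_mono f2_seg) (auto simp: Q_def)
    also have "?B + (?B + (?B + ?B)) = 4 * ?B" by argo
    finally show ?thesis .
  qed
  hence "2 * pi * norm (h w - h c) \<le> 2 * pi * (8 * M * norm \<delta> ^ 2 / \<rho> ^ 2)"
    unfolding norm_mult s(2) by (simp add: power2_eq_square mult_ac)
  hence "norm (h w - h c) \<le> 8 * M * norm \<delta> ^ 2 / \<rho> ^ 2"
    by (subst (asm) mult_le_cancel_left_pos) auto
  moreover have "h w - h c = r w - r c - (\<Sum>d\<in>D. principal_part r d w - principal_part r d c)"
    using np by (simp add: h_eq h0_def sum_subtractf)
  ultimately show ?thesis by (simp add: \<delta>_def D_def)
qed

section \<open>Periodicity of the Weierstrass function\<close>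

text \<open>The terms are of size |n|^(-3/2). The exponent is half of that in the double series, so
  that the latter is dominated by a product.\<close>

lemma summable_on_int_powr: "(\<lambda>n::int. (1 + real_of_int n ^ 2) powr (- 3/4)) summable_on UNIV"
proof -
  have nat: "(\<lambda>n::nat. (1 + real n ^ 2) powr (- 3/4)) summable_on UNIV"
  proof (rule summable_nonneg_imp_summable_on)
    have "summable (\<lambda>n. real n powr (- 3/2))" by (simp add: summable_real_powr_iff)
    thus "summable (\<lambda>n. (1 + real n ^ 2) powr (- 3/4))"
    proof (rule summable_comparison_test_ev[rotated])
      show "\<forall>\<^sub>F n in sequentially. norm ((1 + real n ^ 2) powr (- 3/4)) \<le> real n powr (- 3/2)"
        using eventually_gt_at_top[of 0]
      proof eventually_elim
        case (elim n)
        have "real n ^ 2 = real n powr 2" using elim by (simp add: powr_numeral)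
        hence "real n powr (- 3/2) = (real n ^ 2) powr (- 3/4)" by (simp only: powr_powr) simp
        moreover have "(1 + real n ^ 2) powr (- 3/4) \<le> (real n ^ 2) powr (- 3/4)"
          using elim by (intro powr_mono2') auto
        ultimately show ?case by simp
      qed
    qed
  qed simp
  let ?h = "\<lambda>n::int. (1 + real_of_int n ^ 2) powr (- 3/4)"
  have "?h summable_on range int"
    by (subst summable_on_reindex) (use nat in \<open>auto simp: o_def\<close>)
  moreover have "?h summable_on range (\<lambda>n. - int n)"
    by (subst summable_on_reindex) (use nat in \<open>auto simp: o_def inj_def\<close>)
  hence "?h summable_on (range (\<lambda>n. - int n) - range int)"
    by (rule summable_on_subset_banach) auto
  ultimately have "?h summable_on (range int \<union> (range (\<lambda>n. - int n) - range int))"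
    by (rule summable_on_Un_disjoint) auto
  also have "range int \<union> (range (\<lambda>n. - int n) - range int) = UNIV"
    using int_cases2 by blast
  finally show ?thesis .
qed

text \<open>As 1 + m^2 + n^2 is at least 1 + m^2 and at least 1 + n^2, splitting the power into two
  equal factors gives a product of two single series as majorant.\<close>

lemma summable_on_int_prod_powr:
  "(\<lambda>(m, n). (1 + real_of_int m ^ 2 + real_of_int n ^ 2) powr (- 3/2)) summable_on UNIV"
proof -
  let ?h = "\<lambda>n::int. (1 + real_of_int n ^ 2) powr (- 3/4)"
  have h: "(\<lambda>n. norm (?h n)) summable_on UNIV" using summable_on_int_powr by simp
  have "(\<lambda>x. norm (case x of (m, n) \<Rightarrow> ?h m * ?h n)) summable_on UNIV \<times> UNIV"
    unfolding Infinite_Sum.abs_summable_on_Sigma_iff using h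
    by (simp add: abs_mult infsum_cmult_right' summable_on_cmult_right summable_on_cmult_left del: UNIV_Times_UNIV)
  hence "(\<lambda>x. norm (case x of (m, n) \<Rightarrow> (1 + real_of_int m ^ 2 + real_of_int n ^ 2) powr (- 3/2))) summable_on UNIV \<times> UNIV"
  proof (rule Infinite_Sum.abs_summable_on_comparison_test)
    fix x :: "int \<times> int"
    obtain m n where x: "x = (m, n)" by force
    let ?s = "1 + real_of_int m ^ 2 + real_of_int n ^ 2"
    have "?s powr (- 3/2) = ?s powr (- 3/4) * ?s powr (- 3/4)"
      by (simp flip: powr_add)
    also have "\<dots> \<le> ?h m * ?h n"
      by (intro mult_mono powr_mono2') (auto simp: add_pos_nonneg)
    finally show "norm (case x of (m, n) \<Rightarrow> (1 + real_of_int m ^ 2 + real_of_int n ^ 2) powr (- 3/2))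
        \<le> norm (case x of (m, n) \<Rightarrow> ?h m * ?h n)"
      by (simp add: x)
  qed
  from abs_summable_summable[OF this] show ?thesis by simp
qed

text \<open>The leading terms 1 / l^2 cancel, which leaves cubic decay. Both |u - l| and |v - l| are
  at least |l| / 2, and 48 = 3 * 16.\<close>

lemma norm_diff_inverse_squares:
  fixes u v l :: complex
  assumes l: "norm l > 2 * (norm u + norm v) + 1"
  shows "norm (1 / (u - l) ^ 2 - 1 / (v - l) ^ 2) \<le> 48 * norm (u - v) / norm l ^ 3"
proof -
  have "norm l / 2 \<le> norm (l - u)"
    using l norm_triangle_ineq2[of l u] norm_ge_zero[of u] norm_ge_zero[of v] by argo
  moreover have "norm l / 2 \<le> norm (l - v)"
    using l norm_triangle_ineq2[of l v] norm_ge_zero[of u] norm_ge_zero[of v] by argo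
  ultimately have nul: "norm (u - l) \<ge> norm l / 2" "norm (v - l) \<ge> norm l / 2"
    by (simp_all add: norm_minus_commute)
  have pos: "norm l > 0" using l norm_ge_zero[of u] norm_ge_zero[of v] by argo
  have ne: "u \<noteq> l" "v \<noteq> l" using nul pos by auto
  have "1 / (u - l) ^ 2 - 1 / (v - l) ^ 2 = (v - u) * ((u - l) + (v - l)) / ((u - l) ^ 2 * (v - l) ^ 2)"
    using ne by (simp add: divide_simps) (simp add: algebra_simps power2_eq_square)
  also have "norm \<dots> \<le> norm (u - v) * (3 * norm l) / ((norm l / 2) ^ 2 * (norm l / 2) ^ 2)"
    unfolding norm_divide norm_mult norm_power norm_minus_commute[of v u]
  proof (intro frac_le mult_mono power_mono order_refl)
    show "norm (u - l + (v - l)) \<le> 3 * norm l"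
      using norm_triangle_ineq[of "u - l" "v - l"] norm_triangle_ineq4[of u l] norm_triangle_ineq4[of v l] l norm_ge_zero[of u] norm_ge_zero[of v] by argo
  qed (use nul pos in auto)
  also have "\<dots> = 48 * norm (u - v) / norm l ^ 3"
    using pos by (simp add: field_simps eval_nat_numeral)
  finally show ?thesis .
qed

text \<open>A quantitative form of linear independence over the reals, in the shape that comparison
  tests for lattice sums use directly.\<close>

locale period_pair =
  fixes \<omega>1 \<omega>2 :: complex and c :: real
  assumes c: "c > 0"
    and lower: "c * sqrt (real_of_int m ^ 2 + real_of_int n ^ 2)
    \<le> norm (of_int m * \<omega>1 + of_int n * \<omega>2)"
begin

abbreviation lat :: "int \<times> int \<Rightarrow> complex" where
  "lat p \<equiv> of_int (fst p) * \<omega>1 + of_int (snd p) * \<omega>2"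

lemma swap: "period_pair \<omega>2 \<omega>1 c"
proof
  fix m n
  show "c * sqrt (real_of_int m ^ 2 + real_of_int n ^ 2) \<le> norm (of_int m * \<omega>2 + of_int n * \<omega>1)"
    using lower[of n m] by (simp add: add.commute)
qed (rule c)

lemma finite_small: "finite {p. norm (lat p) \<le> R}"
proof (rule finite_subset)
  show "{p. norm (lat p) \<le> R} \<subseteq> {- \<lceil>R / c\<rceil>..\<lceil>R / c\<rceil>} \<times> {- \<lceil>R / c\<rceil>..\<lceil>R / c\<rceil>}"
  proof
    fix p assume p: "p \<in> {p. norm (lat p) \<le> R}"
    obtain m n where mn: "p = (m, n)" by force
    have le: "sqrt (real_of_int m ^ 2 + real_of_int n ^ 2) \<le> R / c"
      using lower[of m n] p c by (simp add: mn field_simps)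
    have "\<bar>real_of_int m\<bar> \<le> sqrt (real_of_int m ^ 2 + real_of_int n ^ 2)"
      "\<bar>real_of_int n\<bar> \<le> sqrt (real_of_int m ^ 2 + real_of_int n ^ 2)"
      by (auto intro: real_le_rsqrt)
    with le have "\<bar>real_of_int m\<bar> \<le> R / c" "\<bar>real_of_int n\<bar> \<le> R / c" by linarith+
    thus "p \<in> {- \<lceil>R / c\<rceil>..\<lceil>R / c\<rceil>} \<times> {- \<lceil>R / c\<rceil>..\<lceil>R / c\<rceil>}"
      by (simp add: mn) linarith
  qed
qed simp

text \<open>Apart from finitely many p, the terms are dominated by the inverse cube of the Euclidean
  norm of p.\<close>

lemma summable_comparison:
  fixes f :: "int \<times> int \<Rightarrow> complex"
  assumes "\<And>p. norm (lat p) > R \<Longrightarrow> norm (f p) \<le> B / norm (lat p) ^ 3"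
  shows "f summable_on A"
proof -
  \<comment> \<open>Ensures that \<open>lat p\<close> is nonzero outside \<open>?S\<close>.\<close>
  define R' where "R' = max R 0"
  let ?S = "{p. norm (lat p) \<le> R'}"
  have B: "B \<ge> 0" if "norm (lat p) > R'" for p
  proof (rule ccontr)
    assume "\<not> B \<ge> 0"
    with that have "B / norm (lat p) ^ 3 < 0" unfolding R'_def by (intro divide_neg_pos) auto
    with assms[of p] that show False using norm_ge_zero[of "f p"] unfolding R'_def by linarith
  qed
  \<comment> \<open>The factor 2^(3/2) pays for replacing m^2 + n^2, which is at least 1, by the
    smaller (1 + m^2 + n^2) / 2.\<close>
  define g where "g = (\<lambda>(m::int, n::int). B * (2 powr (3/2) / c ^ 3) * (1 + real_of_int m ^ 2 + real_of_int n ^ 2) powr (- 3/2))"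
  have "g summable_on UNIV" unfolding g_def
    using summable_on_cmult_right[OF summable_on_int_prod_powr, of "B * (2 powr (3/2) / c ^ 3)"]
    unfolding case_prod_unfold .
  hence g: "g summable_on (- ?S)" by (rule summable_on_subset_banach) auto
  have "(\<lambda>p. norm (f p)) summable_on (- ?S)"
  proof (rule Infinite_Sum.abs_summable_on_comparison_test'[OF g])
    fix p assume p: "p \<in> - ?S"
    obtain m n where mn: "p = (m, n)" by force
    let ?s = "real_of_int m ^ 2 + real_of_int n ^ 2"
    have pos: "norm (lat p) > 0" using p unfolding R'_def by auto
    have "(m, n) \<noteq> (0, 0)" using pos by (auto simp: mn)
    hence "m ^ 2 + n ^ 2 \<ge> 1" by (auto simp: int_one_le_iff_zero_less sum_power2_gt_zero_iff)
    hence s: "?s \<ge> 1" by (metis of_int_add of_int_le_iff of_int_power of_int_1)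
    hence s0: "?s \<noteq> 0" by linarith
    have "norm (f p) \<le> B / norm (lat p) ^ 3" using p assms unfolding R'_def by simp
    also have "\<dots> \<le> B / (c * sqrt ?s) ^ 3"
      using lower[of m n] B[of p] p c s pos by (intro divide_left_mono power_mono mult_pos_pos zero_less_power) (auto simp: mn)
    also have "(c * sqrt ?s) ^ 3 = c ^ 3 * ?s powr (3/2)"
      using s using s0 powr_power[of ?s "1/2" 3] by (simp add: power_mult_distrib powr_half_sqrt)
    also have "B / (c ^ 3 * ?s powr (3/2)) = B / c ^ 3 * ?s powr (- 3/2)"
      using powr_minus_divide[of ?s "3/2"] by simp
    also have "\<dots> \<le> B / c ^ 3 * ((1 + ?s) / 2) powr (- 3/2)"
      using s B[of p] p c by (intro mult_left_mono powr_mono2') auto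
    also have "\<dots> = g p"
      using powr_minus_divide[of "2::real" "3/2"] by (simp add: g_def mn powr_divide add.assoc)
    finally show "norm (f p) \<le> g p" .
  qed
  hence "f summable_on (- ?S)" by (rule abs_summable_summable)
  hence "f summable_on (- ?S \<union> ?S)"
    by (rule summable_on_Un_disjoint) (use finite_small in auto)
  hence "f summable_on UNIV" by (simp add: Un_commute)
  thus ?thesis by (rule summable_on_subset_banach) simp
qed

lemma summable_diff: "(\<lambda>p. 1 / (u - lat p) ^ 2 - 1 / (v - lat p) ^ 2) summable_on A"
  by (rule summable_comparison[where R = "2 * (norm u + norm v) + 1"])
     (rule norm_diff_inverse_squares)

text \<open>The series of 1 / (u - l)^2 converges absolutely along each row of fixed m, but not over
  the whole lattice. The series of differences does converge absolutely, so it may be summed row by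
  row, and each row is the difference of a series and its own shift. If u is a lattice point, the
  term with vanishing denominator is 0 by convention and shifts with the rest.\<close>

lemma infsum_diff_shift: "infsum (\<lambda>p. 1 / (u + \<omega>2 - lat p) ^ 2 - 1 / (u - lat p) ^ 2) UNIV = 0"
proof -
  let ?a = "\<lambda>m n::int. 1 / (u - (of_int m * \<omega>1 + of_int n * \<omega>2)) ^ 2"
  have sum_row: "(\<lambda>n. ?a m n) summable_on UNIV" for m
  proof -
    let ?f = "\<lambda>n. ?a m n"
    \<comment> \<open>Outside this finite set |u - l| is at least |l| / 2, and n is nonzero, as the
      comparison with 1 / n^2 requires.\<close>
    let ?S = "{n. norm (lat (m, n)) \<le> 2 * norm u} \<union> {0}"
    have "finite ({p. norm (lat p) \<le> 2 * norm u} \<inter> range (Pair m))"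
      using finite_small by blast
    hence "finite (Pair m -` ({p. norm (lat p) \<le> 2 * norm u} \<inter> range (Pair m)))"
      by (rule finite_vimageI) (auto simp: inj_def)
    hence fin: "finite ?S" by (simp add: vimage_def)
    have g: "(\<lambda>n::int. 8 / c ^ 2 * (1 + real_of_int n ^ 2) powr (- 3/4)) summable_on (- ?S)"
      by (intro summable_on_cmult_right summable_on_subset_banach[OF summable_on_int_powr]) auto
    have "(\<lambda>n. norm (?f n)) summable_on (- ?S)"
    proof (rule Infinite_Sum.abs_summable_on_comparison_test'[OF g])
      fix n assume n: "n \<in> - ?S"
      have n1: "real_of_int n ^ 2 \<ge> 1"
      proof -
        have "n ^ 2 \<ge> 1" using n by (auto simp: int_one_le_iff_zero_less)
        thus ?thesis by (metis of_int_le_iff of_int_power of_int_1)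
      qed
      let ?l = "of_int m * \<omega>1 + of_int n * \<omega>2"
      have "norm (u - ?l) \<ge> norm ?l / 2"
        using n norm_triangle_ineq2[of ?l u] unfolding norm_minus_commute[of u] by simp
      moreover have "norm ?l \<ge> c * sqrt (real_of_int n ^ 2)"
        by (rule order_trans[OF _ lower]) (use c in \<open>auto intro!: mult_left_mono real_sqrt_le_mono\<close>)
      ultimately have *: "norm (u - ?l) \<ge> c * sqrt (real_of_int n ^ 2) / 2" by linarith
      have "norm (?f n) = 1 / norm (u - ?l) ^ 2" by (simp add: norm_divide norm_power)
      also have "\<dots> \<le> 1 / (c * sqrt (real_of_int n ^ 2) / 2) ^ 2"
        using c n * by (intro divide_left_mono power_mono mult_pos_pos zero_less_power) (auto intro: less_le_trans[OF _ *])
      also have "\<dots> = 4 / c ^ 2 * (1 / real_of_int n ^ 2)"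
        by (simp add: power_mult_distrib power_divide)
      also have "\<dots> \<le> 4 / c ^ 2 * (2 / (1 + real_of_int n ^ 2))"
        using n1 c by (intro mult_left_mono) (auto simp: divide_simps)
      also have "\<dots> = 8 / c ^ 2 * (1 + real_of_int n ^ 2) powr (- 1)"
        by (simp add: powr_minus field_simps)
      also have "\<dots> \<le> 8 / c ^ 2 * (1 + real_of_int n ^ 2) powr (- 3/4)"
        by (intro mult_left_mono powr_mono) auto
      finally show "norm (?f n) \<le> 8 / c ^ 2 * (1 + real_of_int n ^ 2) powr (- 3/4)" .
    qed
    hence "?f summable_on (- ?S)" by (rule abs_summable_summable)
    hence "?f summable_on (- ?S \<union> ?S)"
      by (rule summable_on_Un_disjoint) (use fin in auto)
    thus ?thesis by (simp only: Un_commute Compl_partition)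
  qed
  let ?b = "\<lambda>(m, n). ?a m (n - 1) - ?a m n"
  have eq: "(\<lambda>p. 1 / (u + \<omega>2 - lat p) ^ 2 - 1 / (u - lat p) ^ 2) = ?b"
    by (auto simp: fun_eq_iff algebra_simps)
  have "infsum ?b (UNIV \<times> UNIV) = infsum (\<lambda>m. infsum (\<lambda>n. ?b (m, n)) UNIV) UNIV"
    using summable_diff[of "u + \<omega>2" u UNIV] unfolding eq by (subst infsum_Sigma_banach) auto
  also have "(\<lambda>m. infsum (\<lambda>n. ?b (m, n)) UNIV) = (\<lambda>m. 0)"
  proof
    fix m
    have bij: "bij_betw (\<lambda>n::int. n - 1) UNIV UNIV"
      by (rule bij_betwI[of _ _ _ "\<lambda>n. n + 1"]) auto
    have s1: "(\<lambda>n. ?a m (n - 1)) summable_on UNIV"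
      using sum_row[of m] by (subst summable_on_reindex_bij_betw[OF bij])
    have "infsum (\<lambda>n. ?b (m, n)) UNIV = infsum (\<lambda>n. ?a m (n - 1) + - ?a m n) UNIV"
      unfolding prod.case add_uminus_conv_diff ..
    also have "\<dots> = infsum (\<lambda>n. ?a m (n - 1)) UNIV + - infsum (\<lambda>n. ?a m n) UNIV"
      unfolding infsum_uminus[symmetric] by (rule infsum_add[OF s1 summable_on_uminus[THEN iffD2, OF sum_row[of m]]])
    also have "infsum (\<lambda>n. ?a m (n - 1)) UNIV = infsum (\<lambda>n. ?a m n) UNIV"
      by (rule infsum_reindex_bij_betw[OF bij])
    finally show "infsum (\<lambda>n. ?b (m, n)) UNIV = 0" unfolding add.right_inverse .
  qed
  finally show ?thesis unfolding eq UNIV_Times_UNIV infsum_0_simp .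
qed

text \<open>The shift changes the leading term 1 / u^2 by the summand at (0, 0) of the vanishing sum
  over all lattice points. The other summands make up the change of the series, so the two changes
  cancel.\<close>

lemma weierstrass_p_plus_period:
  "weierstrass_p \<omega>1 \<omega>2 (u + \<omega>2) = weierstrass_p \<omega>1 \<omega>2 u"
proof (cases "u \<in> period_lattice \<omega>1 \<omega>2")
  case True
  then obtain m n where "u = of_int m * \<omega>1 + of_int n * \<omega>2" by (auto simp: period_lattice_def)
  hence "u + \<omega>2 = of_int m * \<omega>1 + of_int (n + 1) * \<omega>2" by (simp add: algebra_simps)
  hence "u + \<omega>2 \<in> period_lattice \<omega>1 \<omega>2" unfolding period_lattice_def by blast
  with True show ?thesis by (simp add: weierstrass_p_def)
next
  case False
  have nin: "u + \<omega>2 \<notin> period_lattice \<omega>1 \<omega>2"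
  proof
    assume "u + \<omega>2 \<in> period_lattice \<omega>1 \<omega>2"
    then obtain m n where "u + \<omega>2 = of_int m * \<omega>1 + of_int n * \<omega>2" by (auto simp: period_lattice_def)
    hence "u = of_int m * \<omega>1 + of_int (n - 1) * \<omega>2" by (simp add: algebra_simps)
    with False show False unfolding period_lattice_def by blast
  qed
  define Z where "Z = (UNIV - {(0, 0)} :: (int \<times> int) set)"
  let ?g = "\<lambda>u p. 1 / (u - lat p) ^ 2 - 1 / lat p ^ 2"
  have summable: "?g v summable_on Z" for v
    using summable_diff[of v 0 Z] unfolding diff_0 power2_minus .
  let ?d = "\<lambda>p. 1 / (u + \<omega>2 - lat p) ^ 2 - 1 / (u - lat p) ^ 2"
  have "infsum ?d Z = infsum (\<lambda>p. ?g (u + \<omega>2) p + - ?g u p) Z"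
    by (intro infsum_cong) simp
  also have "\<dots> = infsum (?g (u + \<omega>2)) Z + infsum (\<lambda>p. - ?g u p) Z"
    by (rule infsum_add[OF summable summable_on_uminus[THEN iffD2, OF summable]])
  also have "\<dots> = infsum (?g (u + \<omega>2)) Z - infsum (?g u) Z"
    unfolding infsum_uminus by (rule add_uminus_conv_diff)
  finally have "infsum ?d Z = infsum (?g (u + \<omega>2)) Z - infsum (?g u) Z" .
  moreover have "infsum ?d (Z \<union> {(0, 0)}) = infsum ?d Z + infsum ?d {(0, 0)}"
    by (rule infsum_Un_disjoint) (auto simp: Z_def intro: summable_diff)
  moreover have "Z \<union> {(0, 0)} = UNIV" by (auto simp: Z_def)
  moreover have "infsum ?d {(0, 0)} = 1 / (u + \<omega>2) ^ 2 - 1 / u ^ 2" by simp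
  ultimately have "0 = infsum (?g (u + \<omega>2)) Z - infsum (?g u) Z + (1 / (u + \<omega>2) ^ 2 - 1 / u ^ 2)"
    using infsum_diff_shift[of u] by metis
  hence "1 / (u + \<omega>2) ^ 2 + infsum (?g (u + \<omega>2)) Z = 1 / u ^ 2 + infsum (?g u) Z"
    by (auto simp only: diff_add_eq add_diff_eq diff_diff_eq2 eq_diff_eq add.left_neutral add.commute)
  thus ?thesis using False nin
    by (simp only: weierstrass_p_def case_prod_unfold Z_def if_False)
qed

end

section \<open>Symmetries of the Weierstrass function\<close>

lemma weierstrass_p_uminus: "weierstrass_p \<omega>1 \<omega>2 (- u) = weierstrass_p \<omega>1 \<omega>2 u"
proof -
  have neg: "- v \<in> period_lattice \<omega>1 \<omega>2" if "v \<in> period_lattice \<omega>1 \<omega>2" for v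
  proof -
    from that obtain m n where "v = of_int m * \<omega>1 + of_int n * \<omega>2" by (auto simp: period_lattice_def)
    hence "- v = of_int (- m) * \<omega>1 + of_int (- n) * \<omega>2" by simp
    thus ?thesis unfolding period_lattice_def by blast
  qed
  have iff: "- u \<in> period_lattice \<omega>1 \<omega>2 \<longleftrightarrow> u \<in> period_lattice \<omega>1 \<omega>2"
    using neg[of u] neg[of "- u"] by auto
  let ?f = "\<lambda>u (m, n). 1 / (u - (of_int m * \<omega>1 + of_int n * \<omega>2))\<^sup>2 - 1 / (of_int m * \<omega>1 + of_int n * \<omega>2)\<^sup>2"
  have "infsum (?f (- u)) (UNIV - {(0, 0)}) = infsum (\<lambda>p. ?f (- u) (case p of (m, n) \<Rightarrow> (- m, - n))) (UNIV - {(0, 0)})"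
    by (rule infsum_reindex_bij_betw[symmetric], rule bij_betwI[of _ _ _ "\<lambda>(m, n). (- m, - n)"]) auto
  also have "\<dots> = infsum (?f u) (UNIV - {(0, 0)})"
  proof (intro infsum_cong)
    fix p :: "int \<times> int"
    obtain m n where p: "p = (m, n)" by force
    let ?l = "of_int m * \<omega>1 + of_int n * \<omega>2"
    have "- u - (of_int (- m) * \<omega>1 + of_int (- n) * \<omega>2) = - (u - ?l)"
      "of_int (- m) * \<omega>1 + of_int (- n) * \<omega>2 = - ?l" by simp_all
    thus "?f (- u) (case p of (m, n) \<Rightarrow> (- m, - n)) = ?f u p"
      by (simp only: p prod.case power2_minus)
  qed
  finally show ?thesis unfolding weierstrass_p_def iff power2_minus by (rule arg_cong)
qed

lemma weierstrass_p_swap: "weierstrass_p \<omega>1 \<omega>2 u = weierstrass_p \<omega>2 \<omega>1 u"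
proof -
  have iff: "period_lattice \<omega>1 \<omega>2 = period_lattice \<omega>2 \<omega>1"
  proof -
    have "period_lattice a b \<subseteq> period_lattice b a" for a b
    proof
      fix x assume "x \<in> period_lattice a b"
      then obtain m n where "x = of_int n * b + of_int m * a"
        by (auto simp: period_lattice_def add.commute)
      thus "x \<in> period_lattice b a" unfolding period_lattice_def by blast
    qed
    thus ?thesis by blast
  qed
  let ?f = "\<lambda>\<omega>1 \<omega>2 (m, n). 1 / (u - (of_int m * \<omega>1 + of_int n * \<omega>2))\<^sup>2 - 1 / (of_int m * \<omega>1 + of_int n * \<omega>2)\<^sup>2"
  have "infsum (?f \<omega>1 \<omega>2) (UNIV - {(0, 0)}) = infsum (\<lambda>p. ?f \<omega>1 \<omega>2 (prod.swap p)) (UNIV - {(0, 0)})"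
    by (rule infsum_reindex_bij_betw[symmetric], rule bij_betwI[of _ _ _ prod.swap]) auto
  also have "\<dots> = infsum (?f \<omega>2 \<omega>1) (UNIV - {(0, 0)})"
    by (intro infsum_cong) (auto simp: add.commute)
  finally show ?thesis unfolding weierstrass_p_def iff by (rule arg_cong)
qed

text \<open>Evenness together with both periods; invariance under \<omega>1 follows from that under
  the second period by exchanging the two.\<close>

lemma (in period_pair) weierstrass_p_reflect:
  "weierstrass_p \<omega>1 \<omega>2 (\<omega>1 + \<omega>2 - u) = weierstrass_p \<omega>1 \<omega>2 u"
proof -
  have "weierstrass_p \<omega>1 \<omega>2 (- u + \<omega>1 + \<omega>2) = weierstrass_p \<omega>2 \<omega>1 (- u + \<omega>1)"
    unfolding weierstrass_p_plus_period by (rule weierstrass_p_swap)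
  also have "\<dots> = weierstrass_p \<omega>1 \<omega>2 u"
    unfolding period_pair.weierstrass_p_plus_period[OF swap] weierstrass_p_uminus
    by (rule weierstrass_p_swap)
  finally show ?thesis by (simp add: algebra_simps)
qed

text \<open>The periods are orthogonal, so the squared norm is (m s)^2 + (n t)^2.\<close>

lemma period_pair_rectangular:
  fixes s t :: real
  assumes "s > 0" "t > 0"
  shows "period_pair (\<i> * of_real s) (of_real t) (min s t)"
proof
  fix m n :: int
  have "norm (of_int m * (\<i> * of_real s) + of_int n * of_real t) = sqrt ((real_of_int n * t) ^ 2 + (real_of_int m * s) ^ 2)"
    by (simp add: cmod_def)
  also have "\<dots> \<ge> sqrt ((real_of_int n * min s t) ^ 2 + (real_of_int m * min s t) ^ 2)"
    using assms unfolding power_mult_distrib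
    by (intro real_sqrt_le_mono add_mono mult_left_mono power_mono) auto
  also have "sqrt ((real_of_int n * min s t) ^ 2 + (real_of_int m * min s t) ^ 2) =
      sqrt ((min s t) ^ 2 * (real_of_int m ^ 2 + real_of_int n ^ 2))"
    by (simp add: power_mult_distrib algebra_simps)
  also have "\<dots> = min s t * sqrt (real_of_int m ^ 2 + real_of_int n ^ 2)"
    using assms by (simp add: real_sqrt_mult)
  finally show "min s t * sqrt (real_of_int m ^ 2 + real_of_int n ^ 2) \<le>
      norm (of_int m * (\<i> * of_real s) + of_int n * of_real t)" .
qed (use assms in auto)

section \<open>Positivity of the periods\<close>

text \<open>The integral of a non-integrable function is 0 by convention, so integrability is the
  point. The singularities at both ends are dominated by a multiple of 1 / sqrt ((x - a) (b - x)),
  which has an arcsine as primitive. From below, the integrand is bounded by a positive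
  constant.\<close>

lemma LBINT_inverse_sqrt_pos:
  fixes f q :: "real \<Rightarrow> real"
  assumes ab: "a < b" and q: "continuous_on {a..b} q" "\<And>x. x \<in> {a..b} \<Longrightarrow> q x > 0"
    and f: "\<And>x. f x = (x - a) * (b - x) * q x"
  shows "0 < (LBINT x=ereal a..ereal b. 1 / sqrt (f x))"
proof -
  obtain x0 where x0: "x0 \<in> {a..b}" "\<And>x. x \<in> {a..b} \<Longrightarrow> q x0 \<le> q x"
    using continuous_attains_inf[of "{a..b}" q] q(1) ab by auto
  obtain x1 where x1: "x1 \<in> {a..b}" "\<And>x. x \<in> {a..b} \<Longrightarrow> q x \<le> q x1"
    using continuous_attains_sup[of "{a..b}" q] q(1) ab by auto
  define k where "k = (\<lambda>x. 1 / sqrt ((x - a) * (b - x)))"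
  define h where "h = (\<lambda>x. 1 / sqrt (f x))"
  define M where "M = (b - a) * (b - a) * q x1"
  have eint: "einterval (ereal a) (ereal b) = {a<..<b}" by (auto simp: einterval_def)
  have fpos: "0 < f x \<and> f x \<le> M" if "x \<in> {a<..<b}" for x
    unfolding f M_def using that q(2) x1
    by (auto intro!: mult_mono less_imp_le[OF q(2)])
  have M: "M > 0" using ab q(2)[OF x1(1)] by (simp add: M_def)
  \<comment> \<open>The affine map of [a, b] onto [-1, 1] followed by \<open>arcsin\<close>: a
    primitive of \<open>k\<close>, continuous up to both end points.\<close>
  let ?F = "\<lambda>x. arcsin ((2 * x - a - b) / (b - a))"
  have bnd: "\<bar>(2 * x - a - b) / (b - a)\<bar> < 1" if "a < x" "x < b" for x
    using that by (auto simp: abs_less_iff divide_simps)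
  have contF: "continuous_on {a..b} ?F"
    using ab by (intro continuous_intros) (auto simp: divide_simps)
  have kint: "set_integrable lborel {a<..<b} k"
    unfolding eint[symmetric]
  proof (rule interval_integral_FTC_nonneg(1)[where F = ?F])
    fix x assume "ereal a < ereal x" "ereal x < ereal b"
    hence x: "a < x" "x < b" by auto
    have "1 - ((2 * x - a - b) / (b - a))\<^sup>2 = ((2 / (b - a)) ^ 2) * ((x - a) * (b - x))"
      using ab by (simp add: divide_simps power2_eq_square) (simp add: algebra_simps)
    hence "sqrt (1 - ((2 * x - a - b) / (b - a))\<^sup>2) = 2 / (b - a) * sqrt ((x - a) * (b - x))"
      using ab by (simp add: real_sqrt_mult)
    moreover have "(?F has_real_derivative inverse (sqrt (1 - ((2 * x - a - b) / (b - a))\<^sup>2)) * (2 / (b - a))) (at x)"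
    proof (rule DERIV_chain'[of _ _ _ _ arcsin])
      show "((\<lambda>x. (2 * x - a - b) / (b - a)) has_real_derivative 2 / (b - a)) (at x)"
        using ab by (auto intro!: derivative_eq_intros simp: divide_simps)
      show "(arcsin has_real_derivative inverse (sqrt (1 - ((2 * x - a - b) / (b - a))\<^sup>2)))
          (at ((2 * x - a - b) / (b - a)))"
        using bnd[OF x] unfolding abs_less_iff by (intro DERIV_arcsin) linarith+
    qed
    ultimately show "(?F has_real_derivative k x) (at x)"
      using ab by (simp add: k_def field_simps)
    show "isCont k x" unfolding k_def using x by (intro continuous_intros) auto
  next
    show "((?F \<circ> real_of_ereal) \<longlongrightarrow> ?F a) (at_right (ereal a))"
      unfolding ereal_tendsto_simps by (rule continuous_on_Icc_at_rightD[OF contF ab])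
    show "((?F \<circ> real_of_ereal) \<longlongrightarrow> ?F b) (at_left (ereal b))"
      unfolding ereal_tendsto_simps by (rule continuous_on_Icc_at_leftD[OF contF ab])
  qed (use ab in \<open>auto simp: k_def intro!: AE_I2\<close>)
  have hk: "h x \<le> k x / sqrt (q x0) \<and> 1 / sqrt M \<le> h x" if "x \<in> {a<..<b}" for x
  proof -
    have "k x / sqrt (q x0) = 1 / sqrt ((x - a) * (b - x) * q x0)"
      by (simp add: k_def real_sqrt_mult)
    moreover have "h x \<le> 1 / sqrt ((x - a) * (b - x) * q x0)"
      unfolding h_def f using that x0 q(2)[OF x0(1)] q(2)[of x]
      by (intro divide_left_mono mult_pos_pos real_sqrt_le_mono mult_left_mono) auto
    moreover have "1 / sqrt M \<le> h x"
      unfolding h_def using fpos[OF that] M by (intro divide_left_mono) auto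
    ultimately show ?thesis by simp
  qed
  have hcont: "continuous_on {a<..<b} h"
  proof -
    have "continuous_on {a<..<b} (\<lambda>x. (x - a) * (b - x) * q x)"
      by (intro continuous_intros continuous_on_subset[OF q(1)]) auto
    hence "continuous_on {a<..<b} f" by (simp add: f)
    thus ?thesis unfolding h_def by (intro continuous_intros) (use fpos in force)+
  qed
  have hint: "set_integrable lborel {a<..<b} h"
  proof (rule set_integrable_bound)
    show "set_integrable lborel {a<..<b} (\<lambda>x. k x / sqrt (q x0))"
      using kint by (simp add: set_integrable_divide)
    show "set_borel_measurable lborel {a<..<b} h"
      using borel_measurable_continuous_on_indicator[OF _ hcont]
      by (simp add: set_borel_measurable_def)
    show "AE x in lborel. x \<in> {a<..<b} \<longrightarrow> norm (h x) \<le> norm (k x / sqrt (q x0))"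
    proof (intro AE_I2 impI)
      fix x assume x: "x \<in> {a<..<b}"
      have "0 \<le> h x" using fpos[OF x] by (simp add: h_def)
      with hk[OF x] have "norm (h x) \<le> k x / sqrt (q x0)" by simp
      also have "\<dots> \<le> norm (k x / sqrt (q x0))" unfolding real_norm_def by (rule abs_ge_self)
      finally show "norm (h x) \<le> norm (k x / sqrt (q x0))" .
    qed
  qed
  have cint: "set_integrable lborel {a<..<b} (\<lambda>x. 1 / sqrt M)"
    using ab unfolding set_integrable_def
    by (intro integrable_scaleR_left integrable_real_indicator) auto
  have "0 < (b - a) * (1 / sqrt M)" using M ab by simp
  also have "\<dots> = (LINT x:{a<..<b}|lborel. 1 / sqrt M)"
    using ab by (simp add: set_integral_const)
  also have "\<dots> \<le> (LINT x:{a<..<b}|lborel. h x)"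
    by (rule set_integral_mono[OF cint hint]) (use hk in auto)
  also have "\<dots> = (LBINT x=ereal a..ereal b. h x)"
    using ab by (simp add: interval_lebesgue_integral_def eint)
  finally show ?thesis by (simp add: h_def)
qed

section \<open>Sign of the discriminant\<close>

lemma continuous_pos_of_nonzero:
  fixes g :: "real \<Rightarrow> real"
  assumes "continuous_on {a..b} g" "\<And>x. x \<in> {a..b} \<Longrightarrow> g x \<noteq> 0"
    and "x0 \<in> {a..b}" "g x0 > 0" "x \<in> {a..b}"
  shows "g x > 0"
proof (rule ccontr)
  assume "\<not> g x > 0"
  hence "g x \<le> 0" by simp
  have "connected (g ` {a..b})" using assms(1) by (intro connected_continuous_image) auto
  hence "0 \<in> g ` {a..b}"
    using \<open>g x \<le> 0\<close> assms(3-5) connectedD_interval[of "g ` {a..b}" "g x" "g x0" 0] by auto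
  with assms(2) show False by auto
qed

lemma card_nonsingular_model:
  assumes "nonsingular_model S"
  shows "finite S" "card S > 0"
    "real (card S) = step_ind S (-1) 0 + step_ind S 1 0
       + (step_ind S (-1) 1 + step_ind S 0 1 + step_ind S 1 1)
       + (step_ind S (-1) (-1) + step_ind S 0 (-1) + step_ind S 1 (-1))"
proof -
  have sub: "S \<subseteq> small_steps" and ne: "S \<noteq> {}"
    using assms unfolding nonsingular_model_def nontrivial_model_def by blast+
  have eq: "small_steps = {(-1,0), (1,0), (-1,1), (0,1), (1,1), (-1,-1), (0,-1), (1,-1)}"
  proof -
    have "{-1..1::int} = {-1, 0, 1}" by auto
    thus ?thesis by (auto simp: small_steps_def)
  qed
  have fin: "finite small_steps" by (simp add: eq)
  show "finite S" using sub fin by (rule finite_subset)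
  thus "card S > 0" using ne by (simp add: card_gt_0_iff)
  have "real (card S) = (\<Sum>p\<in>S. 1)" by simp
  also have "\<dots> = (\<Sum>p\<in>small_steps. step_ind S (fst p) (snd p))"
    using sub fin by (intro sum.mono_neutral_cong_left) (auto simp: step_ind_def)
  also have "\<dots> = step_ind S (-1) 0 + step_ind S 1 0
       + (step_ind S (-1) 1 + step_ind S 0 1 + step_ind S 1 1)
       + (step_ind S (-1) (-1) + step_ind S 0 (-1) + step_ind S 1 (-1))"
    by (simp add: eq)
  finally show "real (card S) = step_ind S (-1) 0 + step_ind S 1 0
       + (step_ind S (-1) 1 + step_ind S 0 1 + step_ind S 1 1)
       + (step_ind S (-1) (-1) + step_ind S 0 (-1) + step_ind S 1 (-1))" .
qed

text \<open>Let A, B, D count the steps with vertical component 1, -1, 0. The value is (1 - z D)^2 -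
  4 z^2 A B, which is positive because z (A + B + D) < 1 and 4 A B \<le> (A + B)^2. As 1 lies
  between x2 and x3, this fixes the signs of the discriminant between its branch points.\<close>

lemma disc_x_one_pos:
  assumes S: "nonsingular_model S" and z: "0 < z" "z < 1 / real (card S)"
  shows "poly (disc_x S z) 1 > 0"
proof -
  define A where "A = step_ind S (-1) 1 + step_ind S 0 1 + step_ind S 1 1"
  define B where "B = step_ind S (-1) (-1) + step_ind S 0 (-1) + step_ind S 1 (-1)"
  define D where "D = step_ind S (-1) 0 + step_ind S 1 0"
  have nn: "A \<ge> 0" "B \<ge> 0" by (auto simp: A_def B_def step_ind_def)
  have "z * (D + A + B) < 1"
    using z card_nonsingular_model[OF S] by (simp add: A_def B_def D_def field_simps)
  hence "z * (A + B) < 1 - z * D" by (simp add: algebra_simps)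
  hence "(z * (A + B)) ^ 2 < (1 - z * D) ^ 2"
    using nn z by (intro power_strict_mono) auto
  moreover have "(z * (A + B)) ^ 2 - 4 * z ^ 2 * (A * B) = (z * (A - B)) ^ 2"
    by (simp add: power2_eq_square algebra_simps)
  moreover have "(z * (A - B)) ^ 2 \<ge> 0" by simp
  ultimately have "(1 - z * D) ^ 2 - 4 * z ^ 2 * (A * B) > 0" by linarith
  moreover have "poly (disc_x S z) 1 = (1 - z * D) ^ 2 - 4 * z ^ 2 * (A * B)"
    by (simp add: disc_x_def A_def B_def D_def) (simp add: power2_eq_square algebra_simps)
  ultimately show ?thesis by simp
qed

lemma degree_disc_x: "degree (disc_x S z) \<le> 4"
proof -
  have q: "degree [:a, b, c:] \<le> 2" for a b c :: real by simp
  show ?thesis unfolding disc_x_def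
    by (intro degree_diff_le order_trans[OF degree_power_le] order_trans[OF degree_smult_le]
        order_trans[OF degree_mult_le]) (use q in \<open>auto intro: order_trans[OF add_mono[OF q q]] order_trans[OF mult_right_mono[OF q]]\<close>)
qed

text \<open>Dividing out three roots leaves a factor \<open>e\<close> of degree at most one without
  zero on [-1, x3]. The cofactors of the end points therefore keep, on each interval of integration,
  the sign that they have at 1.\<close>

lemma disc_x_periods_pos:
  assumes S: "nonsingular_model S" and z: "0 < z" "z < 1 / real (card S)"
    and bp: "branch_points (disc_x S z) x1 x2 x3 x4"
  shows "0 < (LBINT t=ereal x1..ereal x2. 1 / sqrt (- poly (disc_x S z) t))"
    and "0 < (LBINT t=ereal x2..ereal x3. 1 / sqrt (poly (disc_x S z) t))"
proof -
  define d where "d = disc_x S z"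
  have d1: "poly d 1 > 0" unfolding d_def by (rule disc_x_one_pos[OF S z])
  have roots: "poly d x1 = 0" "poly d x2 = 0" "poly d x3 = 0"
    and ord: "x1 < x2" "\<bar>x1\<bar> < 1" "\<bar>x2\<bar> < 1" "1 < x3" "ereal x3 \<le> \<bar>x4\<bar>" "x4 \<noteq> ereal x3"
    and x4: "if degree d = 3 then x4 = \<infinity> else \<exists>x. x4 = ereal x \<and> poly d x = 0"
    using bp unfolding branch_points_def d_def by auto
  obtain e where e: "d = [:- x1, 1:] * ([:- x2, 1:] * ([:- x3, 1:] * e))"
  proof -
    obtain e1 where e1: "d = [:- x1, 1:] * e1" using roots(1) by (auto simp: poly_eq_0_iff_dvd elim: dvdE)
    have "poly e1 x2 = 0" using roots(2) ord by (simp add: e1)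
    then obtain e2 where e2: "e1 = [:- x2, 1:] * e2" by (auto simp: poly_eq_0_iff_dvd elim: dvdE)
    have "poly e2 x3 = 0" using roots(3) ord by (auto simp: e1 e2)
    then obtain e where "e2 = [:- x3, 1:] * e" by (auto simp: poly_eq_0_iff_dvd elim: dvdE)
    with that show ?thesis by (simp add: e1 e2)
  qed
  have e0: "e \<noteq> 0" using d1 by (auto simp: e)
  have deg: "degree d = 3 + degree e"
    unfolding e using e0 by (simp add: degree_mult_eq del: mult_pCons_left)
  \<comment> \<open>If x4 is infinite, \<open>e\<close> is a nonzero constant. Otherwise its only
    zero is x4, which differs from x3 and has modulus at least x3, hence lies outside
    [-1, x3].\<close>
  have e_nz: "poly e x \<noteq> 0" if x: "-1 \<le> x" "x \<le> x3" for x
  proof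
    assume ex: "poly e x = 0"
    show False
    proof (cases "degree e = 0")
      case True
      then obtain k where "e = [:k:]" by (rule degree_eq_zeroE)
      with ex e0 show False by simp
    next
      case False
      with x4 deg obtain t where t: "x4 = ereal t" "poly d t = 0" by auto
      with ord have "\<bar>t\<bar> \<ge> x3" "t \<noteq> x3" by auto
      with ord x t(2) have et: "poly e t = 0" and "t \<noteq> x" by (auto simp: e)
      obtain e' where e': "e = [:- t, 1:] * e'" using et by (auto simp: poly_eq_0_iff_dvd elim: dvdE)
      have "degree e' = 0" using deg degree_disc_x[of S z] e0 False
        by (auto simp: d_def[symmetric] e' degree_mult_eq simp del: mult_pCons_left)
      then obtain k where k: "e' = [:k:]" by (rule degree_eq_zeroE)
      show False using ex \<open>t \<noteq> x\<close> e0 by (auto simp: e' k)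
    qed
  qed
  \<comment> \<open>Cofactors of the zeros at the ends of [x1, x2] and of [x2, x3], with signs
    chosen such that both are positive at 1.\<close>
  define q1 where "q1 = (\<lambda>x. (x - x3) * poly e x)"
  define q2 where "q2 = (\<lambda>x. - (x - x1) * poly e x)"
  have dq1: "poly d x = (x - x1) * (x - x2) * q1 x" and dq2: "poly d x = (x - x2) * (x3 - x) * q2 x" for x
    by (simp_all add: e q1_def q2_def algebra_simps)
  have "(1 - x1) * (1 - x2) > 0" using ord by (intro mult_pos_pos) auto
  hence "q1 1 > 0" using d1 unfolding dq1 by (rule zero_less_mult_pos[rotated])
  have q1: "q1 x > 0" if "x \<in> {-1..1}" for x
    by (rule continuous_pos_of_nonzero[of "-1" 1 q1 1 x])
       (use \<open>q1 1 > 0\<close> that e_nz ord in \<open>auto simp: q1_def intro!: continuous_intros\<close>)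
  have "(1 - x2) * (x3 - 1) > 0" using ord by (intro mult_pos_pos) auto
  hence "q2 1 > 0" using d1 unfolding dq2 by (rule zero_less_mult_pos[rotated])
  have q2: "q2 x > 0" if "x \<in> {x2..x3}" for x
    by (rule continuous_pos_of_nonzero[of x2 x3 q2 1 x])
       (use \<open>q2 1 > 0\<close> that e_nz ord in \<open>auto simp: q2_def intro!: continuous_intros\<close>)
  show "0 < (LBINT t=ereal x1..ereal x2. 1 / sqrt (- poly (disc_x S z) t))"
    unfolding d_def[symmetric]
  proof (rule LBINT_inverse_sqrt_pos[of x1 x2 q1])
    show "continuous_on {x1..x2} q1" unfolding q1_def by (intro continuous_intros)
    show "q1 x > 0" if "x \<in> {x1..x2}" for x
    proof -
      have "-1 \<le> x" "x \<le> 1" using ord that by (auto simp: abs_less_iff)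
      thus ?thesis using q1[of x] by simp
    qed
    show "- poly d x = (x - x1) * (x2 - x) * q1 x" for x unfolding dq1 by (simp add: algebra_simps)
  qed (use ord in auto)
  show "0 < (LBINT t=ereal x2..ereal x3. 1 / sqrt (poly (disc_x S z) t))"
    unfolding d_def[symmetric]
    by (rule LBINT_inverse_sqrt_pos[of x2 x3 q2])
       (use ord q2 in \<open>auto simp: dq2 q2_def intro!: continuous_intros\<close>)
qed

section \<open>Boundedness of the generating function\<close>

text \<open>Walks with different end points are different, and walks of length n are words of length
  n over S.\<close>

lemma card_quarter_walks_sum_le:
  assumes "finite S" "finite I"
  shows "(\<Sum>(i, j)\<in>I. card (quarter_walks S i j n)) \<le> card S ^ n"
proof -
  let ?W = "{w. set w \<subseteq> S \<and> length w = n}"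
  have fin: "finite ?W" using assms(1) by (rule finite_lists_length_eq)
  have sub: "quarter_walks S i j n \<subseteq> ?W" for i j by (auto simp: quarter_walks_def)
  have "(\<Sum>(i, j)\<in>I. card (quarter_walks S i j n)) = (\<Sum>p\<in>I. card (quarter_walks S (fst p) (snd p) n))"
    by (simp add: case_prod_unfold)
  also have "\<dots> = card (\<Union>p\<in>I. quarter_walks S (fst p) (snd p) n)"
  proof (rule card_UN_disjoint[symmetric])
    show "\<forall>p\<in>I. \<forall>q\<in>I. p \<noteq> q \<longrightarrow> quarter_walks S (fst p) (snd p) n \<inter> quarter_walks S (fst q) (snd q) n = {}"
      by (auto simp: quarter_walks_def)
  qed (use assms(2) finite_subset[OF sub fin] in blast)+
  also have "\<dots> \<le> card ?W" using sub by (intro card_mono fin) blast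
  also have "\<dots> = card S ^ n" using assms(1) by (rule card_lists_length_eq)
  finally show ?thesis .
qed

text \<open>Finite partial sums, grouped by length, are bounded by the geometric series in z |S|.
  This also gives summability, without which \<open>infsum\<close> would be 0 by convention.\<close>

lemma norm_walk_gf_le:
  assumes S: "finite S" and z: "0 \<le> z" "z * real (card S) < 1" and xy: "norm x \<le> 1" "norm y \<le> 1"
  shows "norm (walk_gf S z x y) \<le> 1 / (1 - z * real (card S))"
proof -
  define q where "q = z * real (card S)"
  let ?f = "\<lambda>(i, j, n). of_nat (card (quarter_walks S i j n)) * x ^ i * y ^ j * of_real z ^ n"
  have q: "0 \<le> q" "q < 1" using z by (auto simp: q_def)
  have bound: "(\<Sum>p\<in>F. norm (?f p)) \<le> 1 / (1 - q)" if F: "finite F" for F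
  proof -
    \<comment> \<open>\<open>N\<close> and \<open>I\<close> enclose \<open>F\<close> in a product
      set, so that for each length the end points can be summed first. The inserted 0 covers empty
      \<open>F\<close>.\<close>
    define N where "N = Max (insert 0 ((\<lambda>(i, j, n). n) ` F))"
    define I where "I = (\<lambda>(i, j, n). (i, j)) ` F"
    have finI: "finite I" using F by (simp add: I_def)
    have sub: "F \<subseteq> (\<lambda>(n, i, j). (i, j, n)) ` ({..N} \<times> I)"
    proof
      fix p assume p: "p \<in> F"
      obtain i j n where ijn: "p = (i, j, n)" by (cases p)
      have "n \<le> N" unfolding N_def using F p ijn by (intro Max_ge) force+
      moreover have "(i, j) \<in> I" using p ijn by (force simp: I_def)
      ultimately show "p \<in> (\<lambda>(n, i, j). (i, j, n)) ` ({..N} \<times> I)" using ijn by force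
    qed
    have "(\<Sum>p\<in>F. norm (?f p)) \<le> (\<Sum>p\<in>F. (case p of (i, j, n) \<Rightarrow> real (card (quarter_walks S i j n)) * z ^ n))"
    proof (rule sum_mono)
      fix p assume "p \<in> F"
      obtain i j n where p: "p = (i, j, n)" by (cases p)
      have "norm (?f p) = real (card (quarter_walks S i j n)) * (norm x ^ i * norm y ^ j) * z ^ n"
        using z by (simp add: p norm_mult norm_power)
      also have "\<dots> \<le> real (card (quarter_walks S i j n)) * 1 * z ^ n"
        using z xy by (intro mult_right_mono mult_left_mono mult_le_one power_le_one) auto
      finally show "norm (?f p) \<le> (case p of (i, j, n) \<Rightarrow> real (card (quarter_walks S i j n)) * z ^ n)"
        by (simp add: p)
    qed
    also have "\<dots> \<le> (\<Sum>p\<in>(\<lambda>(n, i, j). (i, j, n)) ` ({..N} \<times> I).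
        (case p of (i, j, n) \<Rightarrow> real (card (quarter_walks S i j n)) * z ^ n))"
      using sub finI z by (intro sum_mono2) auto
    also have "\<dots> = (\<Sum>(n, i, j)\<in>{..N} \<times> I. real (card (quarter_walks S i j n)) * z ^ n)"
      by (subst sum.reindex) (auto simp: inj_on_def case_prod_unfold)
    also have "\<dots> = (\<Sum>n\<le>N. \<Sum>(i, j)\<in>I. real (card (quarter_walks S i j n)) * z ^ n)"
      by (simp add: sum.cartesian_product)
    also have "\<dots> = (\<Sum>n\<le>N. real (\<Sum>(i, j)\<in>I. card (quarter_walks S i j n)) * z ^ n)"
      by (simp add: sum_distrib_right case_prod_unfold)
    also have "\<dots> \<le> (\<Sum>n\<le>N. real (card S ^ n) * z ^ n)"
      using z card_quarter_walks_sum_le[OF S finI]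
      by (intro sum_mono mult_right_mono of_nat_mono) auto
    also have "\<dots> = (\<Sum>n\<le>N. q ^ n)" by (simp add: q_def power_mult_distrib mult.commute)
    also have "\<dots> \<le> (\<Sum>n. q ^ n)" using q by (intro sum_le_suminf summable_geometric) auto
    also have "\<dots> = 1 / (1 - q)" using q by (intro suminf_geometric) auto
    finally show ?thesis .
  qed
  have "(\<lambda>p. norm (?f p)) summable_on UNIV"
    by (rule nonneg_bdd_above_summable_on) (use bound in \<open>auto intro!: bdd_aboveI2\<close>)
  hence "norm (infsum ?f UNIV) \<le> infsum (\<lambda>p. norm (?f p)) UNIV"
    by (rule norm_infsum_bound)
  also have "\<dots> \<le> 1 / (1 - q)"
    by (rule infsum_le_finite_sums) (use bound \<open>(\<lambda>p. norm (?f p)) summable_on UNIV\<close> in auto)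
  finally show ?thesis by (simp add: walk_gf_def q_def)
qed

lemma norm_walk_kernel_le:
  fixes x y :: "'a::real_normed_field"
  assumes "0 \<le> z" "norm x \<le> 1" "norm y \<le> 1"
  shows "norm (walk_kernel S z x y) \<le> z * real (card S) + 1"
proof -
  have "norm (\<Sum>(i, j)\<in>S. x ^ nat (i + 1) * y ^ nat (j + 1)) \<le> (\<Sum>p\<in>S. 1)"
    by (rule sum_norm_le)
       (use assms in \<open>auto simp: norm_mult norm_power case_prod_unfold intro!: mult_le_one power_le_one\<close>)
  hence "norm (\<Sum>(i, j)\<in>S. x ^ nat (i + 1) * y ^ nat (j + 1)) \<le> real (card S)" by simp
  hence "z * norm (\<Sum>(i, j)\<in>S. x ^ nat (i + 1) * y ^ nat (j + 1)) \<le> z * real (card S)"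
    using assms(1) by (rule mult_left_mono)
  moreover have "norm (x * y) \<le> 1" using assms by (simp add: norm_mult mult_le_one)
  ultimately show ?thesis unfolding walk_kernel_def
    using norm_triangle_ineq4[of "of_real z * (\<Sum>(i, j)\<in>S. x ^ nat (i + 1) * y ^ nat (j + 1))" "x * y"] assms(1)
    by (simp add: norm_mult)
qed

section \<open>Partial fraction expansion\<close>

text \<open>The shift by \<omega>3 / 2 turns the reflection into u -> \<omega>1 + \<omega>2 - u,
  under which the Weierstrass function is invariant.\<close>

lemma y_unif_reflect:
  assumes "period_pair \<omega>1 \<omega>2 k"
  shows "y_unif d y4 \<omega>1 \<omega>2 \<omega>3 (\<omega>1 + \<omega>2 + \<omega>3 - \<zeta>) = y_unif d y4 \<omega>1 \<omega>2 \<omega>3 \<zeta>"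
proof -
  have "\<omega>1 + \<omega>2 + \<omega>3 - \<zeta> - \<omega>3 / 2 = \<omega>1 + \<omega>2 - (\<zeta> - \<omega>3 / 2)" by (simp add: field_simps)
  thus ?thesis unfolding y_unif_def
    by (simp only: period_pair.weierstrass_p_reflect[OF assms])
qed

theorem theorem7:
  fixes S :: "(int \<times> int) set" and z :: real
    and x1 x2 x3 y1 y2 y3 :: real and x4 y4 :: ereal
    and \<omega>1 \<omega>2 \<omega>3 \<omega>y2 :: complex
    and y :: "complex \<Rightarrow> riemann_sphere"
    and \<Delta> :: "complex set" and r :: "complex \<Rightarrow> complex"
    and P :: "nat \<Rightarrow> complex set" and C1 C2 :: real and \<omega> :: complex
  assumes model: "nonsingular_model S"
    and z: "0 < z" "z < 1 / real (card S)"
    and bp_x: "branch_points (disc_x S z) x1 x2 x3 x4"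
    and bp_y: "branch_points (disc_y S z) y1 y2 y3 y4"
    and \<omega>1: "\<omega>1 = \<i> * complex_of_real (LBINT t=ereal x1..ereal x2. 1 / sqrt (- poly (disc_x S z) t))"
    and \<omega>2: "\<omega>2 = complex_of_real (LBINT t=ereal x2..ereal x3. 1 / sqrt (poly (disc_x S z) t))"
    and \<omega>3: "\<omega>3 = complex_of_real (LBINT t=kernel_root S z y1..ereal x1. 1 / sqrt (poly (disc_x S z) t))"
    and \<omega>y2: "\<omega>y2 = (\<omega>1 + \<omega>2 + \<omega>3) / 2"
    and y: "y = y_unif (disc_y S z) y4 \<omega>1 \<omega>2 \<omega>3"
    and \<Delta>_component: "\<Delta> \<in> components {\<zeta>. \<exists>w. y \<zeta> = Fin w \<and> norm w < 1}"
    and \<Delta>_line: "{\<zeta>. Re \<zeta> = Re \<omega>y2} \<subseteq> \<Delta>"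
    and r_meromorphic: "r nicely_meromorphic_on UNIV"
    and r_eq: "\<And>\<zeta> w. \<zeta> \<in> \<Delta> \<Longrightarrow> y \<zeta> = Fin w \<Longrightarrow> r \<zeta> = walk_kernel S z 0 w * walk_gf S z 0 w"
    and P_parallelogram: "\<And>m. m \<ge> 1 \<Longrightarrow> parallelogram (P m)"
    and P_incr: "\<And>m. m \<ge> 1 \<Longrightarrow> P m \<subseteq> P (Suc m)"
    and P_union: "(\<Union>m\<in>{1..}. P m) = UNIV"
    and P_centered: "\<And>m. m \<ge> 1 \<Longrightarrow> symmetric_about \<omega>y2 (P m)"
    and C_pos: "C1 > 0" "C2 > 0"
    and r_bound: "\<And>m \<zeta>. m \<ge> 1 \<Longrightarrow> \<zeta> \<in> frontier (P m) \<Longrightarrow> norm (r \<zeta>) \<le> C1 * real m"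
    and P_dist: "\<And>m \<zeta>. m \<ge> 1 \<Longrightarrow> \<zeta> \<in> frontier (P m) \<Longrightarrow> C2 * real m \<le> norm (\<zeta> - \<omega>y2)"
    and not_pole: "\<not> is_pole r \<omega>"
  shows "(\<lambda>m. \<Sum>d\<in>{d \<in> P m. is_pole r d}. principal_part r d \<omega> - principal_part r d \<omega>y2)
           \<longlonglongrightarrow> r \<omega> - r \<omega>y2"
proof -
  define l where "l = {\<zeta>. Re \<zeta> = Re \<omega>y2}"
  note per = disc_x_periods_pos[OF model z bp_x]
  define k where "k = min (LBINT t=ereal x1..ereal x2. 1 / sqrt (- poly (disc_x S z) t))
    (LBINT t=ereal x2..ereal x3. 1 / sqrt (poly (disc_x S z) t))"
  \<comment> \<open>\<omega>1 is purely imaginary, \<omega>2 is real and neither vanishes, so the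
    lattice is rectangular.\<close>
  have lat: "period_pair \<omega>1 \<omega>2 k" unfolding \<omega>1 \<omega>2 k_def by (rule period_pair_rectangular[OF per])
  have two_c: "2 * \<omega>y2 = \<omega>1 + \<omega>2 + \<omega>3" unfolding \<omega>y2 by simp
  have y_refl: "y (2 * \<omega>y2 - \<zeta>) = y \<zeta>" for \<zeta>
    unfolding y two_c by (rule y_unif_reflect[OF lat])
  \<comment> \<open>The line lies in \<Delta>, where |y| < 1, so on it \<open>r\<close> is given by
    the generating function inside its domain of convergence.\<close>
  have on_line: "\<exists>w. norm w < 1 \<and> y \<zeta> = Fin w \<and> r \<zeta> = walk_kernel S z 0 w * walk_gf S z 0 w"
    if "\<zeta> \<in> l" for \<zeta>
  proof -
    have D: "\<zeta> \<in> \<Delta>" using that \<Delta>_line by (auto simp: l_def)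
    hence "\<zeta> \<in> {\<zeta>. \<exists>w. y \<zeta> = Fin w \<and> norm w < 1}" using in_components_subset[OF \<Delta>_component] by blast
    then obtain w where w: "y \<zeta> = Fin w" "norm w < 1" by blast
    with r_eq[OF D w(1)] show ?thesis by blast
  qed
  have islim: "\<omega>y2 islimpt l"
  proof (rule connected_imp_perfect)
    have "l = (\<lambda>t. Complex (Re \<omega>y2) t) ` UNIV"
      by (auto simp: l_def image_iff complex_eq_iff)
    moreover have "connected ((\<lambda>t. Complex (Re \<omega>y2) t) ` UNIV)"
      by (intro connected_continuous_image continuous_intros connected_UNIV)
    ultimately show "connected l" by simp
    have "\<omega>y2 \<in> l" "\<omega>y2 + \<i> \<in> l" by (auto simp: l_def)
    thus "l \<noteq> {b}" for b by (metis add_cancel_right_right complex_i_not_zero singletonD)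
    show "\<omega>y2 \<in> l" by fact
  qed
  have refl_line: "r (2 * \<omega>y2 - \<zeta>) = r \<zeta>" if \<zeta>: "\<zeta> \<in> l" for \<zeta>
  proof -
    obtain w where w: "y \<zeta> = Fin w" "r \<zeta> = walk_kernel S z 0 w * walk_gf S z 0 w"
      using on_line[OF \<zeta>] by blast
    \<comment> \<open>The line is invariant under the reflection and \<open>y\<close> agrees at both
      points, hence so does \<open>r\<close>.\<close>
    have "2 * \<omega>y2 - \<zeta> \<in> l" using \<zeta> by (simp add: l_def)
    hence "2 * \<omega>y2 - \<zeta> \<in> \<Delta>" using \<Delta>_line by (auto simp: l_def)
    from r_eq[OF this, of w] show ?thesis using w by (simp add: y_refl)
  qed
  have zS: "z * real (card S) < 1" using z card_nonsingular_model(2)[OF model] by (simp add: field_simps)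
  have bounded: "norm (r \<zeta>) \<le> (z * real (card S) + 1) * (1 / (1 - z * real (card S)))" if \<zeta>: "\<zeta> \<in> l" for \<zeta>
  proof -
    obtain w where w: "norm w < 1" "r \<zeta> = walk_kernel S z 0 w * walk_gf S z 0 w"
      using on_line[OF \<zeta>] by blast
    show ?thesis unfolding w(2) norm_mult
      using w(1) z zS card_nonsingular_model(1)[OF model]
      by (intro mult_mono norm_walk_kernel_le norm_walk_gf_le) auto
  qed
  \<comment> \<open>This makes \<open>r \<omega>y2\<close> a genuine value of the function rather
    than a convention at a pole.\<close>
  have np: "\<not> is_pole r \<omega>y2" by (rule not_is_pole_if_bounded[OF islim bounded])
  have even: "r (2 * \<omega>y2 - x) = r x" if "\<not> is_pole r x" "\<not> is_pole r (2 * \<omega>y2 - x)" for x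
    by (rule meromorphic_reflect_eq[OF r_meromorphic islim refl_line that])
  define s where "s = (\<lambda>m. \<Sum>d\<in>{d \<in> P m. is_pole r d}. principal_part r d \<omega> - principal_part r d \<omega>y2)"
  \<comment> \<open>The estimate with M = C1 m and \<rho> = C2 m reads K / m. It applies once C2 m
    exceeds 2 |\<omega> - \<omega>y2|.\<close>
  define K where "K = 8 * C1 * norm (\<omega> - \<omega>y2) ^ 2 / C2 ^ 2"
  have "\<forall>\<^sub>F m in sequentially. real m > 2 * norm (\<omega> - \<omega>y2) / C2"
    by (rule eventually_compose_filterlim[OF eventually_gt_at_top filterlim_real_sequentially])
  hence "\<forall>\<^sub>F m in sequentially. norm (r \<omega> - r \<omega>y2 - s m) \<le> K * inverse (real m)"
    using eventually_ge_at_top[of 1]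
  proof eventually_elim
    case (elim m)
    have "2 * norm (\<omega> - \<omega>y2) < C2 * real m" using elim(1) C_pos by (simp add: field_simps)
    from parallelogram_partial_fraction_estimate[OF r_meromorphic P_parallelogram[OF elim(2)]
        P_centered[OF elim(2)] even np not_pole r_bound[OF elim(2)] P_dist[OF elim(2)] this]
    have "norm (r \<omega> - r \<omega>y2 - s m) \<le> 8 * (C1 * real m) * norm (\<omega> - \<omega>y2) ^ 2 / (C2 * real m) ^ 2"
      by (simp add: s_def)
    also have "\<dots> = K * inverse (real m)"
      using elim(2) C_pos by (simp add: K_def field_simps power2_eq_square)
    finally show ?case .
  qed
  moreover have "(\<lambda>m. K * inverse (real m)) \<longlonglongrightarrow> K * 0"
    by (intro tendsto_mult tendsto_const lim_inverse_n)
  hence "(\<lambda>m. K * inverse (real m)) \<longlonglongrightarrow> 0" by simp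
  ultimately have "(\<lambda>m. r \<omega> - r \<omega>y2 - s m) \<longlonglongrightarrow> 0" by (rule Lim_null_comparison)
  from tendsto_diff[OF tendsto_const this, of "r \<omega> - r \<omega>y2"] show ?thesis by (simp add: s_def)
qed

end
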